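(* Let $n\ge2$, $p\in\mathbb{N}$ and $0<j<n$. For any $K\in\mathcal{K}(\mathbb{R}^n)$ one has $$V\big(-\Delta_pK[j],K^p[np-j]\big)\leq\frac{n^n}{(n-j)^{n-j}j^j}|K|^p.$$
   Context: $\mathcal{K}(\mathbb{R}^n)$ denotes the set of convex bodies, i.e. nonempty compact convex subsets of $\mathbb{R}^n$; $|\cdot|$ is Lebesgue measure (in the dimension of the ambient space). The mixed volume of $K_1,\dots,K_N\in\mathcal{K}(\mathbb{R}^N)$ is $V(K_1,\dots,K_N)=\frac1{N!}\frac{\partial^N}{\partial t_1\cdots\partial t_N}\big|_{t_1=\dots=t_N=0}|t_1K_1+\dots+t_NK_N|$ (Minkowski sums; the volume is a homogeneous polynomial of degree $N$ in $t_1,\dots,t_N\ge0$). $L[k]$ means that $L$ is repeated $k$ times. Identify $\mathbb{R}^{np}=(\mathbb{R}^n)^p$; $\Delta_p:\mathbb{R}^n\to\mathbb{R}^{np}$, $\Delta_p(x)=(x,\dots,x)$; $-\Delta_pK=\{-\Delta_p(x):x\in K\}$; $K^p=K\times\cdots\times K\subset\mathbb{R}^{np}$. Here $j$ is an integer. *)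

theory Defs
  imports "HOL-Analysis.Analysis"
begin

definition convex_body :: "'a::euclidean_space set \<Rightarrow> bool" where
  "convex_body K \<longleftrightarrow> K \<noteq> {} \<and> compact K \<and> convex K"

(* Partial derivative of a function on the orthant of nonnegative reals. It is one-sided
   on the boundary: the volume of a Minkowski combination is a polynomial in the coefficients
   only as long as these are nonnegative. *)
definition partial_orthant ::
    "nat \<Rightarrow> ((nat \<Rightarrow> real) \<Rightarrow> real) \<Rightarrow> (nat \<Rightarrow> real) \<Rightarrow> real" where
  "partial_orthant i f t = vector_derivative (\<lambda>s. f (t(i := s))) (at (t i) within {0..})"

(* Volume of t_0 K_0 + ... + t_(N-1) K_(N-1); the sum is the Minkowski sum of Set_Algebras. *)
definition minkowski_volume :: "'a::euclidean_space set list \<Rightarrow> (nat \<Rightarrow> real) \<Rightarrow> real" where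
  "minkowski_volume Ks t =
     measure lebesgue (\<Sum>i<length Ks. (\<lambda>x. t i *\<^sub>R x) ` (Ks ! i))"

(* Only meaningful for lists Ks of length DIM('a). *)
definition mixed_volume :: "'a::euclidean_space set list \<Rightarrow> real" where
  "mixed_volume Ks =
     foldr partial_orthant [0..<length Ks] (minkowski_volume Ks) (\<lambda>_. 0) / fact (length Ks)"

definition cartesian_power :: "'a set \<Rightarrow> ('a ^ 'p) set" where
  "cartesian_power K = {x. \<forall>i. x $ i \<in> K}"

end

theory Submission imports Defs "HOL-Probability.Distributions" begin

text \<open>
  Write \<open>L = - \<Delta> K\<close>, \<open>M = K\<^sup>p\<close>, \<open>N = n p\<close>. The volume of \<open>a L + b M\<close> is a polynomial
  \<open>\<Sum>\<^sub>k C\<^sub>k a\<^sup>k b\<^sup>N\<^sup>-\<^sup>k\<close> with nonnegative coefficients, and the mixed volume is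
  \<open>C\<^sub>j j! (N - j)! / N!\<close>. If \<open>x\<close> lies in \<open>(S - \<rho>) L + (T - \<rho>) M\<close>, then the set of those \<open>w\<close> in \<open>S K\<close>
  with \<open>x + \<Delta> w\<close> in \<open>T K\<^sup>p\<close> contains a translate of \<open>\<rho> K\<close>. Integrating the volume of this set over
  \<open>x\<close> by Fubini on one side, and by layers \<open>\<rho>\<close> on the other, gives
  \<open>\<integral> n \<rho>\<^sup>n\<^sup>-\<^sup>1 |(S - \<rho>) L + (T - \<rho>) M| d\<rho> \<le> S\<^sup>n T\<^sup>N |K|\<^sup>p\<close>, the integral being over
  \<open>0 \<le> \<rho> \<le> min S T\<close>. Keeping only the term with index \<open>j\<close> of the polynomial and integrating against
  \<open>exp (- \<alpha> S - \<beta> T)\<close> with \<open>\<alpha> = (n - j) / n\<close> and \<open>\<beta> = j / n\<close> yields the bound.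
\<close>

section \<open>Volume under linear maps\<close>

text \<open>The mixed volume is defined through derivatives, so nothing can be said about it before
  the volume is known to be a polynomial; and nonnegativity of its coefficients is what allows all
  terms but one to be dropped. Both facts come from one tiling: for two polytopes, the combinations
  with coefficients a and b are cut, for all positive a and b simultaneously, into sums of two
  simplices in complementary directions, each of volume c a^k b^(N-k) with c \<ge> 0. Compactness of
  the coefficients passes this on to general bodies. The fibre inequality couples S, T and \<rho>
  through S - \<rho> and T - \<rho>. The exponential weight undoes this: for fixed \<rho>, S and T
  integrate to constants times exp(- \<alpha> \<rho>) and exp(- \<beta> \<rho>). For all positive
  weights with \<alpha> + \<beta> = 1, a normalisation of scale, the outcome is the bound |K|^p /
  (\<alpha>^(n-j) \<beta>^j). The denominator is largest at \<alpha> = (n-j)/n, \<beta> = j/n, which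
  is the origin of n^n / ((n-j)^(n-j) j^j). Bodies of volume zero are treated apart, since the
  argument divides by |K|.\<close>

lemma translation_invariant_proportional:
  fixes M :: "'a::euclidean_space measure"
  assumes sets_M: "sets M = sets borel" and "sigma_finite_measure M"
    and inv: "\<And>x. distr M borel ((+) x) = M"
  obtains c where "\<And>A. A \<in> sets borel \<Longrightarrow> emeasure M A = c * emeasure lborel A"
proof -
  interpret M: sigma_finite_measure M by fact
  interpret P: pair_sigma_finite M "lborel :: 'a measure" ..
  have [measurable_cong]: "sets M = sets borel" by fact
  define B :: "'a set" where "B = box (- One) One"
  have [measurable]: "B \<in> sets borel" by (simp add: B_def)
  have B0: "emeasure lborel B = ennreal (2 ^ DIM('a))"
    by (simp add: B_def emeasure_lborel_box_eq inner_diff_left inner_add_left)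
  have shiftM: "(\<integral>\<^sup>+x. f x \<partial>M) = (\<integral>\<^sup>+x. f (y + x) \<partial>M)"
    if [measurable]: "f \<in> borel_measurable borel" for f :: "'a \<Rightarrow> ennreal" and y
    by (subst inv[of y, symmetric], subst nn_integral_distr) auto
  have shiftL: "(\<integral>\<^sup>+x. f x \<partial>lborel) = (\<integral>\<^sup>+x. f (y + x) \<partial>lborel)"
    if [measurable]: "f \<in> borel_measurable borel" for f :: "'a \<Rightarrow> ennreal" and y
    by (subst lborel_distr_plus[of y, symmetric], subst nn_integral_distr) auto
  define c0 where "c0 = (\<integral>\<^sup>+x. indicator B (- x) \<partial>M)"
  \<comment> \<open>The uniqueness argument for Haar measure: in the double integral of 1_A(x)
    1_B(y), x is first shifted by y under \<open>M\<close>, then y by -x under Lebesgue measure.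
    This moves the coupling of x and y from \<open>A\<close> to \<open>B\<close>, and one more shift
    turns the inner integral into the constant \<open>c0\<close>. The cube \<open>B\<close> has
    positive finite volume, so it can be divided out.\<close>
  have eq: "emeasure M A * emeasure lborel B = c0 * emeasure lborel A"
    if [measurable]: "A \<in> sets borel" for A
  proof -
    have "emeasure M A * emeasure lborel B
        = (\<integral>\<^sup>+y. (\<integral>\<^sup>+x. indicator A x * indicator B y \<partial>M) \<partial>lborel)"
      by (simp add: nn_integral_multc nn_integral_cmult sets_M)
    also have "\<dots> = (\<integral>\<^sup>+y. (\<integral>\<^sup>+x. indicator A (y + x) * indicator B y \<partial>M) \<partial>lborel)"
      by (intro nn_integral_cong shiftM) measurable
    also have "\<dots> = (\<integral>\<^sup>+x. (\<integral>\<^sup>+y. indicator A (y + x) * indicator B y \<partial>lborel) \<partial>M)"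
      by (rule P.Fubini') measurable
    also have "\<dots> = (\<integral>\<^sup>+x. (\<integral>\<^sup>+y. indicator A y * indicator B (y - x) \<partial>lborel) \<partial>M)"
    proof (rule nn_integral_cong)
      fix x :: 'a
      have "(\<integral>\<^sup>+y. indicator A y * indicator B (y - x) \<partial>lborel)
          = (\<integral>\<^sup>+y. indicator A (x + y) * (indicator B (x + y - x) :: ennreal) \<partial>lborel)"
        by (rule shiftL) measurable
      then show "(\<integral>\<^sup>+y. indicator A (y + x) * indicator B y \<partial>lborel)
          = (\<integral>\<^sup>+y. indicator A y * (indicator B (y - x) :: ennreal) \<partial>lborel)"
        by (simp add: add.commute)
    qed
    also have "\<dots> = (\<integral>\<^sup>+y. (\<integral>\<^sup>+x. indicator A y * indicator B (y - x) \<partial>M) \<partial>lborel)"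
      by (rule P.Fubini'[symmetric]) measurable
    also have "\<dots> = (\<integral>\<^sup>+y. c0 * indicator A y \<partial>lborel)"
    proof (rule nn_integral_cong)
      fix y :: 'a
      have "(\<integral>\<^sup>+x. indicator B (y - x) \<partial>M) = (\<integral>\<^sup>+x. indicator B (y - (y + x)) \<partial>M)"
        by (rule shiftM) measurable
      then show "(\<integral>\<^sup>+x. indicator A y * indicator B (y - x) \<partial>M) = c0 * indicator A y"
        by (subst nn_integral_cmult) (auto simp: c0_def mult.commute)
    qed
    also have "\<dots> = c0 * emeasure lborel A"
      by (subst nn_integral_cmult_indicator) auto
    finally show ?thesis .
  qed
  show ?thesis
  proof
    fix A :: "'a set" assume "A \<in> sets borel"
    from eq[OF this] have "emeasure M A * ennreal (2 ^ DIM('a)) = c0 * emeasure lborel A"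
      by (simp add: B0)
    then have "emeasure M A * ennreal (2 ^ DIM('a)) * ennreal (1 / 2 ^ DIM('a))
        = c0 * emeasure lborel A * ennreal (1 / 2 ^ DIM('a))"
      by simp
    then show "emeasure M A = (c0 * ennreal (1 / 2 ^ DIM('a))) * emeasure lborel A"
      by (simp add: mult.assoc ennreal_mult[symmetric]) (simp add: ac_simps)
  qed
qed

lemma borel_measurable_linear:
  fixes f :: "'a::euclidean_space \<Rightarrow> 'b::euclidean_space"
  shows "linear f \<Longrightarrow> f \<in> borel_measurable borel"
  by (simp add: borel_measurable_continuous_onI linear_continuous_on linear_conv_bounded_linear)

lemma sets_borel_linear_image:
  fixes f :: "'a::euclidean_space \<Rightarrow> 'a"
  assumes "linear f" "bij f" "A \<in> sets borel"
  shows "f ` A \<in> sets borel"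
proof -
  have "linear (inv f)"
    using assms(1,2) by (simp add: bij_def linear_inj_imp_surj inj_linear_imp_inv_linear)
  then have "inv f -` A \<inter> space borel \<in> sets borel"
    using assms(3) by (intro measurable_sets[OF borel_measurable_linear])
  then show ?thesis
    using assms(2) by (simp add: bij_vimage_eq_inv_image bij_imp_bij_inv inv_inv_eq)
qed

text \<open>The measure taking A to the volume of f A is again translation invariant, because
  \<open>f\<close> carries a shift by x into a shift by f x; hence it is a multiple of Lebesgue
  measure. The factor stays anonymous: it is applied only where it cancels.\<close>

lemma emeasure_linear_image_proportional:
  fixes f :: "'a::euclidean_space \<Rightarrow> 'a"
  assumes f: "linear f" "bij f"
  obtains c where "\<And>A. A \<in> sets borel \<Longrightarrow> emeasure lborel (f ` A) = c * emeasure lborel A"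
proof -
  define M where "M = distr lborel borel (inv f)"
  have li: "linear (inv f)"
    using f by (simp add: bij_def inj_linear_imp_inv_linear)
  have [measurable]: "inv f \<in> borel_measurable borel"
    by (rule borel_measurable_linear[OF li])
  have M: "emeasure M A = emeasure lborel (f ` A)" if "A \<in> sets borel" for A
    unfolding M_def using that f(2)
    by (subst emeasure_distr) (auto simp: bij_vimage_eq_inv_image bij_imp_bij_inv inv_inv_eq)
  have inv: "distr M borel ((+) x) = M" for x
  proof -
    have "distr M borel ((+) x) = distr lborel borel (\<lambda>y. x + inv f y)"
      unfolding M_def by (subst distr_distr) (auto simp: comp_def)
    also have "(\<lambda>y. x + inv f y) = (\<lambda>y. inv f (f x + y))"
      using f(2) by (auto simp: linear_add[OF li] bij_is_inj)
    also have "distr lborel borel \<dots> = distr (distr lborel borel ((+) (f x))) borel (inv f)"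
      by (subst distr_distr) (auto simp: comp_def)
    also have "\<dots> = M" by (simp add: lborel_distr_plus M_def)
    finally show ?thesis .
  qed
  have "sigma_finite_measure M"
  proof
    let ?C = "range (\<lambda>n::nat. inv f ` box (- real n *\<^sub>R One) (real n *\<^sub>R One))"
    have lf: "inv f ` box a b \<in> sets borel" for a b
      using li f(2) by (intro sets_borel_linear_image) (auto simp: bij_imp_bij_inv)
    have "\<Union>?C = inv f ` (\<Union>n::nat. box (- real n *\<^sub>R One) (real n *\<^sub>R One))" by auto
    also have "\<dots> = UNIV"
      using f(2) by (simp add: UN_box_eq_UNIV bij_imp_bij_inv bij_is_surj)
    finally have "\<Union>?C = UNIV" .
    moreover have "emeasure M (inv f ` box a b) \<noteq> \<infinity>" for a b
      using M[OF lf] f(2)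
      by (simp add: image_image bij_is_surj surj_f_inv_f emeasure_lborel_box_eq)
    ultimately show "\<exists>A. countable A \<and> A \<subseteq> sets M \<and> \<Union>A = space M \<and> (\<forall>a\<in>A. emeasure M a \<noteq> \<infinity>)"
      by (intro exI[of _ ?C]) (auto simp: M_def lf)
  qed
  from translation_invariant_proportional[OF _ this inv]
  obtain c where "\<And>A. A \<in> sets borel \<Longrightarrow> emeasure M A = c * emeasure lborel A"
    by (auto simp: M_def)
  with M show ?thesis by (intro that[of c]) auto
qed

section \<open>Volume of images under maps that are diagonal in some basis\<close>

lemma coordinate_scaling_linear_bij:
  fixes s :: "'a::euclidean_space \<Rightarrow> real"
  assumes s: "\<And>b. b \<in> Basis \<Longrightarrow> s b > 0"
  defines "S \<equiv> \<lambda>x. \<Sum>b\<in>Basis. (s b * (x \<bullet> b)) *\<^sub>R b"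
  shows "linear S" "bij S"
proof -
  show lin: "linear S" unfolding S_def
    by (intro linearI) (auto simp: inner_add_left algebra_simps sum.distrib scaleR_sum_right)
  have "inj S"
  proof (rule injI, rule euclidean_eqI)
    fix x y b :: 'a assume eq: "S x = S y" and b: "b \<in> Basis"
    have "S x \<bullet> b = S y \<bullet> b" by (simp add: eq)
    then have "s b * (x \<bullet> b) = s b * (y \<bullet> b)"
      using b by (simp add: S_def inner_sum_left_Basis)
    then show "x \<bullet> b = y \<bullet> b" using s[OF b] by simp
  qed
  then show "bij S" using lin by (simp add: bij_def linear_inj_imp_surj)
qed

lemma emeasure_lborel_coordinate_scaling:
  fixes s :: "'a::euclidean_space \<Rightarrow> real"
  assumes s: "\<And>b. b \<in> Basis \<Longrightarrow> s b > 0" and A: "A \<in> sets borel"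
  shows "emeasure lborel ((\<lambda>x. \<Sum>b\<in>Basis. (s b * (x \<bullet> b)) *\<^sub>R b) ` A)
    = ennreal (\<Prod>b\<in>Basis. s b) * emeasure lborel A"
proof -
  let ?S = "\<lambda>x::'a. \<Sum>b\<in>Basis. (s b * (x \<bullet> b)) *\<^sub>R b"
  note lin = coordinate_scaling_linear_bij(1)[of s, OF s] and bij = coordinate_scaling_linear_bij(2)[of s, OF s]
  have SA: "?S ` A \<in> sets borel" by (rule sets_borel_linear_image[OF lin bij A])
  have [measurable]: "?S \<in> borel_measurable borel" by (rule borel_measurable_linear[OF lin])
  have "lborel = density (distr lborel borel ?S) (\<lambda>_. (\<Prod>j\<in>Basis. \<bar>s j\<bar>))"
    using lborel_affine_euclidean[of s 0] s by force
  then have "emeasure lborel (?S ` A)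
     = emeasure (density (distr lborel borel ?S) (\<lambda>_. (\<Prod>j\<in>Basis. \<bar>s j\<bar>))) (?S ` A)" by simp
  also have "\<dots> = (\<Prod>j\<in>Basis. \<bar>s j\<bar>) * emeasure lborel (?S -` (?S ` A) \<inter> space lborel)"
    using SA by (subst emeasure_density) (auto simp: nn_integral_cmult emeasure_distr)
  also have "?S -` (?S ` A) \<inter> space lborel = A"
    using bij by (simp add: bij_is_inj inj_vimage_image_eq)
  also have "(\<Prod>j\<in>Basis. \<bar>s j\<bar>) = (\<Prod>j\<in>Basis. s j)"
    using s by (intro prod.cong) (auto simp: less_imp_le)
  finally show ?thesis by simp
qed

text \<open>If \<open>J\<close> carries the coordinate basis to \<open>B\<close>, then
  \<open>D\<close> is the conjugate by \<open>J\<close> of the coordinate scaling \<open>?S\<close>.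
  The unknown volume factor of \<open>J\<close> is compensated by that of \<open>inv J\<close>, and
  only the product of the scalings remains.\<close>

lemma emeasure_lborel_basis_scaling:
  fixes B :: "'a::euclidean_space set"
  assumes B: "independent B" "span B = UNIV" and s: "\<And>b. b \<in> B \<Longrightarrow> s b > 0"
    and D: "linear D" "\<And>b. b \<in> B \<Longrightarrow> D b = s b *\<^sub>R b" and X: "X \<in> sets borel"
  shows "emeasure lborel (D ` X) = ennreal (\<Prod>b\<in>B. s b) * emeasure lborel X"
proof -
  have cardB: "card B = DIM('a)"
    by (metis B dim_UNIV dim_span_eq_card_independent)
  have "finite B" using B independent_imp_finite by blast
  then obtain \<phi> where \<phi>: "bij_betw \<phi> (Basis::'a set) B"
    using cardB by (metis finite_Basis finite_same_card_bij)
  obtain J where J: "linear J" "\<And>b. b \<in> Basis \<Longrightarrow> J b = \<phi> b"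
    using linear_independent_extend[OF independent_Basis] by blast
  have "B \<subseteq> range J"
    using \<phi> J(2) by (auto simp: bij_betw_def) (metis imageE rangeI)
  then have "surj J"
    using B(2) J(1) by (metis linear_subspace_image span_minimal subspace_UNIV top.extremum_uniqueI)
  then have bij: "bij J" using J(1) by (simp add: bij_def linear_surj_imp_inj)
  let ?S = "\<lambda>x::'a. \<Sum>b\<in>Basis. (s (J b) * (x \<bullet> b)) *\<^sub>R b"
  have sJ: "s (J b) > 0" if "b \<in> Basis" for b
    using that \<phi> J(2) s by (auto simp: bij_betw_def)
  have comm: "D (J x) = J (?S x)" for x
  proof -
    have "D (J x) = D (J (\<Sum>b\<in>Basis. (x \<bullet> b) *\<^sub>R b))" by (simp add: euclidean_representation)
    also have "\<dots> = (\<Sum>b\<in>Basis. (x \<bullet> b) *\<^sub>R D (J b))"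
      by (simp add: linear_sum[OF J(1)] linear_cmul[OF J(1)] linear_sum[OF D(1)] linear_cmul[OF D(1)])
    also have "\<dots> = (\<Sum>b\<in>Basis. (x \<bullet> b) *\<^sub>R s (J b) *\<^sub>R J b)"
      using \<phi> by (intro sum.cong) (auto simp: D(2) J(2) bij_betw_def)
    also have "\<dots> = J (?S x)"
      by (simp add: linear_sum[OF J(1)] linear_cmul[OF J(1)] mult.commute)
    finally show ?thesis .
  qed
  have lini: "linear (inv J)" "bij (inv J)"
    using J(1) bij by (simp_all add: bij_def inj_linear_imp_inv_linear bij_imp_bij_inv[unfolded bij_def])
  have X': "inv J ` X \<in> sets borel" using sets_borel_linear_image lini X by blast
  have XJ: "J ` inv J ` X = X" using bij by (simp add: image_image bij_is_surj surj_f_inv_f)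
  have SX: "?S ` inv J ` X \<in> sets borel"
    by (intro sets_borel_linear_image coordinate_scaling_linear_bij sJ X')
  obtain c where c: "\<And>A. A \<in> sets borel \<Longrightarrow> emeasure lborel (J ` A) = c * emeasure lborel A"
    using emeasure_linear_image_proportional[OF J(1) bij] by blast
  have "D ` X = J ` (?S ` (inv J ` X))"
    by (subst XJ[symmetric]) (simp add: image_image comm)
  then have "emeasure lborel (D ` X) = c * emeasure lborel (?S ` (inv J ` X))"
    using c[OF SX] by simp
  also have "\<dots> = ennreal (\<Prod>b\<in>Basis. s (J b)) * (c * emeasure lborel (inv J ` X))"
    using emeasure_lborel_coordinate_scaling[of "\<lambda>b. s (J b)", OF sJ X'] by (simp add: ac_simps)
  also have "c * emeasure lborel (inv J ` X) = emeasure lborel X"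
    using c[OF X'] XJ by simp
  also have "(\<Prod>b\<in>Basis. s (J b)) = (\<Prod>b\<in>B. s b)"
    using prod.reindex_bij_betw[OF \<phi>, of s] J(2) by simp
  finally show ?thesis .
qed

section \<open>Triangulation of a pointed cone by generic heights\<close>

definition conic_hull :: "'a::real_vector set \<Rightarrow> 'a set" where
  "conic_hull U = {z. \<exists>q. (\<forall>u\<in>U. q u \<ge> 0) \<and> z = (\<Sum>u\<in>U. q u *\<^sub>R u)}"

lemma conic_hull_subset_span: "conic_hull U \<subseteq> span U"
  by (auto simp: conic_hull_def intro: span_sum span_scale span_base)

lemma conic_hullI: "(\<And>u. u \<in> U \<Longrightarrow> q u \<ge> 0) \<Longrightarrow> (\<Sum>u\<in>U. q u *\<^sub>R u) \<in> conic_hull U"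
  by (auto simp: conic_hull_def)

lemma conic_hull_mono:
  assumes "finite U" "S \<subseteq> U" shows "conic_hull S \<subseteq> conic_hull U"
proof
  fix z assume "z \<in> conic_hull S"
  then obtain q where q: "\<forall>u\<in>S. q u \<ge> 0" "z = (\<Sum>u\<in>S. q u *\<^sub>R u)" by (auto simp: conic_hull_def)
  have "(\<Sum>u\<in>U. (if u \<in> S then q u else 0) *\<^sub>R u) = (\<Sum>u\<in>S. q u *\<^sub>R u)"
    using assms by (intro sum.mono_neutral_cong_right) auto
  then show "z \<in> conic_hull U"
    using q conic_hullI[of U "\<lambda>u. if u \<in> S then q u else 0"] by auto
qed

text \<open>The pivot rule of the simplex method: \<epsilon> is the smallest ratio
  \<open>q t / c t\<close> over the indices with \<open>c t > 0\<close>. Subtracting \<epsilon>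
  times \<open>c\<close> from \<open>q\<close> keeps all weights nonnegative and annihilates the
  weight at \<open>s\<close>. It serves both to shorten a conic combination and to exchange a basis
  vector.\<close>

lemma ratio_test:
  fixes q c :: "'a \<Rightarrow> real"
  assumes "finite S" "\<And>t. t \<in> S \<Longrightarrow> q t \<ge> 0" "\<exists>t\<in>S. c t > 0"
  obtains \<epsilon> s where "s \<in> S" "c s > 0" "q s = \<epsilon> * c s" "\<epsilon> \<ge> 0" "\<And>t. t \<in> S \<Longrightarrow> q t - \<epsilon> * c t \<ge> 0"
proof -
  let ?P = "{t \<in> S. c t > 0}"
  obtain s where s: "s \<in> ?P" "\<And>t. t \<in> ?P \<Longrightarrow> q s / c s \<le> q t / c t"
    using ex_is_arg_min_if_finite[of ?P "\<lambda>t. q t / c t"] assms(1,3)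
    unfolding is_arg_min_linorder by fastforce
  have "q t - q s / c s * c t \<ge> 0" if "t \<in> S" for t
  proof (cases "c t > 0")
    case True
    with s(2)[of t] that show ?thesis by (simp add: field_simps)
  next
    case False
    then have "q s / c s * c t \<le> 0" using s assms(2) by (intro mult_nonneg_nonpos) auto
    with assms(2)[OF that] show ?thesis by linarith
  qed
  then show ?thesis using s assms(2) by (intro that[of s "q s / c s"]) auto
qed

text \<open>Heights in general position: the lifted points over a linearly independent set never lie on a
  common hyperplane with a further lifted point.\<close>
definition generic_heights :: "'a::real_vector set \<Rightarrow> ('a \<Rightarrow> real) \<Rightarrow> bool" where
  "generic_heights U h \<longleftrightarrow> (\<forall>T u l. T \<subseteq> U \<longrightarrow> independent T \<longrightarrow> u \<in> span T \<longrightarrow> u \<in> U - T \<longrightarrow>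
     linear l \<longrightarrow> (\<forall>t\<in>T. l t = h t) \<longrightarrow> l u \<noteq> h u)"

text \<open>The heights are powers of one number w with distinct exponents \<open>i u\<close>. For
  given \<open>T\<close> and \<open>u\<close>, a bad position makes w a root of
  \<open>p T u\<close>, a polynomial whose coefficient at \<open>i u\<close> is 1. The finitely many
  such polynomials have finitely many roots, so some w avoids them all.\<close>

lemma generic_heights_exist:
  fixes U :: "'a::real_vector set"
  assumes U: "finite U"
  obtains h where "generic_heights U h"
proof -
  obtain i :: "'a \<Rightarrow> nat" where i: "inj_on i U"
    using finite_imp_inj_to_nat_seg[OF U] by blast
  define p where "p T u = monom 1 (i u) - (\<Sum>t\<in>T. monom (representation T u t) (i t))" for T u
  have p0: "p T u \<noteq> 0" if "T \<subseteq> U" "u \<in> U - T" for T u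
  proof -
    have "coeff (\<Sum>t\<in>T. monom (representation T u t) (i t)) (i u) = 0"
    proof -
      have "i t \<noteq> i u" if "t \<in> T" for t
        using that \<open>T \<subseteq> U\<close> \<open>u \<in> U - T\<close> inj_onD[OF i, of t u] by blast
      then show ?thesis by (simp add: coeff_sum)
    qed
    then have "coeff (p T u) (i u) = 1" by (simp add: p_def)
    then show ?thesis by auto
  qed
  let ?I = "{(T, u). T \<subseteq> U \<and> u \<in> U - T}"
  have "finite ?I" by (rule finite_subset[of _ "Pow U \<times> U"]) (use U in auto)
  then have "finite (\<Union>(T,u)\<in>?I. {w. poly (p T u) w = 0})"
    by (rule finite_UN_I) (use p0 in \<open>auto intro!: poly_roots_finite\<close>)
  then obtain w :: real where w: "w \<notin> (\<Union>(T,u)\<in>?I. {w. poly (p T u) w = 0})"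
    using ex_new_if_finite[OF infinite_UNIV_char_0] by blast
  have "generic_heights U (\<lambda>u. w ^ i u)"
    unfolding generic_heights_def
  proof (intro allI impI notI)
    fix T u and l :: "'a \<Rightarrow> real"
    assume T: "T \<subseteq> U" "independent T" "u \<in> span T" "u \<in> U - T" and l: "linear l" "\<forall>t\<in>T. l t = w ^ i t"
      and lu: "l u = w ^ i u"
    have "finite T" using T(1) U finite_subset by blast
    then have u: "(\<Sum>t\<in>T. representation T u t *\<^sub>R t) = u"
      using sum_representation_eq[OF T(2,3)] by simp
    have "l (\<Sum>t\<in>T. representation T u t *\<^sub>R t) = (\<Sum>t\<in>T. representation T u t * l t)"
      by (simp add: linear_sum[OF l(1)] linear_cmul[OF l(1)])
    then have "l u = (\<Sum>t\<in>T. representation T u t * l t)"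
      unfolding u .
    then have "poly (p T u) w = 0"
      using l(2) lu by (simp add: p_def poly_sum poly_monom)
    with w T show False by blast
  qed
  then show ?thesis by (rule that)
qed

section \<open>The simplicial cone through a generic point\<close>

definition generic_point :: "'a::euclidean_space set \<Rightarrow> 'a \<Rightarrow> bool" where
  "generic_point U z \<longleftrightarrow> (\<forall>S\<subseteq>U. card S < DIM('a) \<longrightarrow> z \<notin> span S)"

text \<open>A vanishing coefficient would place the point in the span of fewer than
  \<open>DIM('a)\<close> vectors. Generic points thus avoid the walls of all full-dimensional
  simplicial cones over \<open>U\<close>, which rules out degenerate pivots and overlapping
  cells.\<close>

lemma generic_point_pos:
  fixes U :: "'a::euclidean_space set"
  assumes U: "finite U" "T \<subseteq> U" and "generic_point U (\<Sum>t\<in>T. \<mu> t *\<^sub>R t)" "card T = DIM('a)" "t \<in> T"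
  shows "\<mu> t \<noteq> 0"
proof
  assume "\<mu> t = 0"
  then have "(\<Sum>t\<in>T. \<mu> t *\<^sub>R t) = (\<Sum>t\<in>T - {t}. \<mu> t *\<^sub>R t)"
    using assms finite_subset by (intro sum.mono_neutral_right) auto
  also have "\<dots> \<in> span (T - {t})" by (intro span_sum span_scale span_base)
  moreover have "card (T - {t}) < DIM('a)"
    using assms by (metis card_Diff1_less finite_subset)
  ultimately show False using assms unfolding generic_point_def by (metis Diff_subset subset_trans)
qed

text \<open>Caratheodory's argument on a generating set of least size: a linear dependence would, by
  the ratio test, allow one generator to be discarded. Applying \<sigma> to the dependence shows
  that its coefficients sum to 0, so that one of them is positive, as the test requires. Genericity
  excludes sets with fewer than \<open>DIM('a)\<close> elements.\<close>

lemma generic_point_in_basis_cone: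
  fixes U :: "'a::euclidean_space set"
  assumes U: "finite U" and \<sigma>: "linear \<sigma>" "\<And>u. u \<in> U \<Longrightarrow> \<sigma> u = (1::real)"
    and z: "z \<in> conic_hull U" "generic_point U z"
  obtains T where "T \<subseteq> U" "independent T" "card T = DIM('a)" "z \<in> conic_hull T"
proof -
  obtain S where S: "S \<subseteq> U" "z \<in> conic_hull S"
    and min: "\<And>S'. S' \<subseteq> U \<Longrightarrow> z \<in> conic_hull S' \<Longrightarrow> card S \<le> card S'"
    using arg_min_nat_lemma[of "\<lambda>S. S \<subseteq> U \<and> z \<in> conic_hull S" U card] z(1) by blast
  have finS: "finite S" using S U finite_subset by blast
  obtain q where q: "\<And>u. u \<in> S \<Longrightarrow> q u \<ge> 0" "z = (\<Sum>u\<in>S. q u *\<^sub>R u)"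
    using S(2) by (auto simp: conic_hull_def)
  have "independent S"
  proof (rule ccontr)
    assume "\<not> independent S"
    then obtain c where c: "(\<Sum>s\<in>S. c s *\<^sub>R s) = 0" "\<exists>s\<in>S. c s \<noteq> 0"
      using dependent_finite[OF finS] by blast
    have "(\<Sum>s\<in>S. c s) = \<sigma> (\<Sum>s\<in>S. c s *\<^sub>R s)"
      using S(1) by (simp add: linear_sum[OF \<sigma>(1)] linear_cmul[OF \<sigma>(1)] \<sigma>(2) subset_iff)
    then have c0: "(\<Sum>s\<in>S. c s) = 0" using c(1) linear_0[OF \<sigma>(1)] by simp
    have "\<exists>s\<in>S. c s > 0"
    proof (rule ccontr)
      assume "\<not> ?thesis"
      then have "\<forall>s\<in>S. - c s \<ge> 0" by force
      moreover have "(\<Sum>s\<in>S. - c s) = 0" using c0 by (simp add: sum_negf)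
      ultimately show False using c(2) sum_nonneg_eq_0_iff[OF finS, of "\<lambda>s. - c s"] by auto
    qed
    then obtain \<epsilon> s where \<epsilon>: "s \<in> S" "q s = \<epsilon> * c s" "\<And>t. t \<in> S \<Longrightarrow> q t - \<epsilon> * c t \<ge> 0"
      using ratio_test[OF finS, of q c] q(1) by metis
    have "z = (\<Sum>t\<in>S. (q t - \<epsilon> * c t) *\<^sub>R t)"
      using c(1) by (simp add: q(2) scaleR_diff_left sum_subtractf flip: scaleR_scaleR scaleR_sum_right)
    also have "\<dots> = (\<Sum>t\<in>S - {s}. (q t - \<epsilon> * c t) *\<^sub>R t)"
      using finS \<epsilon> by (intro sum.mono_neutral_right) auto
    also have "\<dots> \<in> conic_hull (S - {s})" using \<epsilon> by (intro conic_hullI) auto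
    finally have "card S \<le> card (S - {s})" using min S(1) by blast
    then show False using \<epsilon>(1) finS by (metis card_Diff1_less not_le)
  qed
  moreover have "card S \<ge> DIM('a)"
    using z(2) S conic_hull_subset_span unfolding generic_point_def by (metis not_le subsetD)
  ultimately show ?thesis using that[of S] S independent_bound by (metis le_antisym)
qed

text \<open>The maximal cells of the regular triangulation induced by \<open>h\<close>: each
  \<open>u\<close> is lifted to height \<open>h u\<close>, and \<open>T\<close> is a cell if the
  other lifted points lie strictly above the hyperplane through the lifted points of
  \<open>T\<close>, which is the graph of \<open>l\<close>.\<close>

definition lower_bases :: "'a::euclidean_space set \<Rightarrow> ('a \<Rightarrow> real) \<Rightarrow> 'a set set" where
  "lower_bases U h = {T. T \<subseteq> U \<and> independent T \<and> card T = DIM('a) \<and>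
     (\<exists>l. linear l \<and> (\<forall>t\<in>T. l t = h t) \<and> (\<forall>u\<in>U - T. l u < h u))}"

text \<open>Linear programming: among the bases whose cones contain \<open>z\<close>, take one that
  minimises the interpolated height \<open>val\<close>. The functional \<open>l\<close> agreeing
  with \<open>h\<close> on it is the dual solution; a generator \<open>u\<close> with
  \<open>l u > h u\<close> could enter the basis and lower the minimum.\<close>

lemma lower_basis_cone_exists:
  fixes U :: "'a::euclidean_space set"
  assumes U: "finite U" and \<sigma>: "linear \<sigma>" "\<And>u. u \<in> U \<Longrightarrow> \<sigma> u = (1::real)"
    and h: "generic_heights U h"
    and z: "z \<in> conic_hull U" "generic_point U z"
  obtains T where "T \<in> lower_bases U h" "z \<in> conic_hull T"
proof -
  let ?B = "{T. T \<subseteq> U \<and> independent T \<and> card T = DIM('a) \<and> z \<in> conic_hull T}"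
  define val where "val T = (\<Sum>t\<in>T. representation T z t * h t)" for T
  have "finite ?B" by (rule finite_subset[of _ "Pow U"]) (use U in auto)
  moreover obtain T\<^sub>0 where "T\<^sub>0 \<subseteq> U" "independent T\<^sub>0" "card T\<^sub>0 = DIM('a)" "z \<in> conic_hull T\<^sub>0"
    by (rule generic_point_in_basis_cone[OF U \<sigma> z])
  then have "?B \<noteq> {}" by blast
  ultimately have "\<exists>T. is_arg_min val (\<lambda>T. T \<in> ?B) T"
    by (intro ex_is_arg_min_if_finite)
  then obtain T where argmin: "is_arg_min val (\<lambda>T. T \<in> ?B) T" ..
  then have min: "val T \<le> val T'" if "T' \<in> ?B" for T'
    using that unfolding is_arg_min_linorder by simp
  have T: "T \<in> ?B" using argmin unfolding is_arg_min_linorder by simp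
  then have TU: "T \<subseteq> U" and ind: "independent T" and cT: "card T = DIM('a)" and zT: "z \<in> conic_hull T"
    by auto
  have finT: "finite T" using TU U finite_subset by blast
  have span: "span T = UNIV" using cT ind by (metis dim_UNIV dim_eq_card dim_eq_full)
  obtain q where q: "\<And>u. u \<in> T \<Longrightarrow> q u \<ge> 0" "z = (\<Sum>u\<in>T. q u *\<^sub>R u)"
    using zT by (auto simp: conic_hull_def)
  obtain l :: "'a \<Rightarrow> real" where l: "linear l" "\<And>t. t \<in> T \<Longrightarrow> l t = h t"
    using linear_independent_extend[OF ind] by blast
  have val: "val S = (\<Sum>t\<in>S. \<mu> t * h t)"
    if "independent S" "finite S" "z = (\<Sum>t\<in>S. \<mu> t *\<^sub>R t)" for S \<mu>
  proof -
    have "z \<in> span S" unfolding that(3) by (intro span_sum span_scale span_base)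
    then have "(\<Sum>t\<in>S. representation S z t *\<^sub>R t) = (\<Sum>t\<in>S. \<mu> t *\<^sub>R t)"
      using sum_representation_eq[OF that(1), of z S] that by simp
    then have z0: "(\<Sum>t\<in>S. (representation S z t - \<mu> t) *\<^sub>R t) = 0"
      by (simp add: scaleR_diff_left sum_subtractf)
    have "representation S z t - \<mu> t = 0" if "t \<in> S" for t
      by (rule independentD[OF \<open>independent S\<close> \<open>finite S\<close> order_refl z0 that])
    then show ?thesis unfolding val_def by (intro sum.cong) auto
  qed
  have le: "l u \<le> h u" if u: "u \<in> U - T" for u
  proof (rule ccontr)
    assume lu: "\<not> l u \<le> h u"
    define c where "c = representation T u"
    have uc: "u = (\<Sum>t\<in>T. c t *\<^sub>R t)"
      using sum_representation_eq[OF ind, of u T] span finT by (simp add: c_def)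
    \<comment> \<open>The coefficients of \<open>u\<close> sum to 1, so one of them is positive and
      some basis vector can leave when \<open>u\<close> enters.\<close>
    have "1 = \<sigma> u" using \<sigma> u by simp
    also have "\<dots> = (\<Sum>t\<in>T. c t)"
      using TU by (subst uc) (simp add: linear_sum[OF \<sigma>(1)] linear_cmul[OF \<sigma>(1)] \<sigma>(2) subset_iff)
    finally have "\<exists>t\<in>T. c t > 0"
      using sum_nonpos[of T c] by (metis not_le zero_less_one)
    then obtain \<epsilon> s where \<epsilon>: "s \<in> T" "c s > 0" "q s = \<epsilon> * c s" "\<epsilon> \<ge> 0" "\<And>t. t \<in> T \<Longrightarrow> q t - \<epsilon> * c t \<ge> 0"
      using ratio_test[OF finT, of q c] q(1) by metis
    \<comment> \<open>Genericity of \<open>z\<close> makes the pivot nondegenerate: \<epsilon> is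
      positive, so the exchange strictly lowers the value.\<close>
    have "q s \<noteq> 0" using generic_point_pos[OF U TU _ cT \<epsilon>(1), of q] z q(2) by simp
    then have "\<epsilon> > 0" using \<epsilon> by (cases "\<epsilon> = 0") auto
    define T' where "T' = insert u (T - {s})"
    have T'U: "T' \<subseteq> U" using TU u by (auto simp: T'_def)
    have finT': "finite T'" using finT by (simp add: T'_def)
    have "u \<notin> span (T - {s})"
    proof
      assume "u \<in> span (T - {s})"
      then have "representation T u s = 0"
        using ind \<epsilon>(1)
        using representation_extend[OF ind, of u "T - {s}"] representation_ne_zero by (metis DiffD2 Diff_subset insertCI)
      then show False using \<epsilon> by (simp add: c_def)
    qed
    then have indT': "independent T'"
      using ind by (simp add: T'_def independent_insert independent_mono[OF ind])
    have cT': "card T' = DIM('a)"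
      using u finT \<epsilon>(1) cT by (simp add: T'_def card_insert_if)
    define \<mu> where "\<mu> t = (if t = u then \<epsilon> else q t - \<epsilon> * c t)" for t
    have sumT': "(\<Sum>t\<in>T'. \<mu> t *\<^sub>R f t) = \<epsilon> *\<^sub>R f u + (\<Sum>t\<in>T. (q t - \<epsilon> * c t) *\<^sub>R f t)" for f :: "'a \<Rightarrow> 'b::real_vector"
    proof -
      have "(\<Sum>t\<in>T'. \<mu> t *\<^sub>R f t) = \<epsilon> *\<^sub>R f u + (\<Sum>t\<in>T - {s}. \<mu> t *\<^sub>R f t)"
        using u finT unfolding T'_def by (subst sum.insert) (auto simp: \<mu>_def)
      also have "(\<Sum>t\<in>T - {s}. \<mu> t *\<^sub>R f t) = (\<Sum>t\<in>T - {s}. (q t - \<epsilon> * c t) *\<^sub>R f t)"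
        using u by (intro sum.cong) (auto simp: \<mu>_def)
      also have "\<dots> = (\<Sum>t\<in>T. (q t - \<epsilon> * c t) *\<^sub>R f t)"
        using finT \<epsilon> by (intro sum.mono_neutral_left) auto
      finally show ?thesis .
    qed
    have zT': "z = (\<Sum>t\<in>T'. \<mu> t *\<^sub>R t)"
      using sumT'[of "\<lambda>t. t"]
      by (simp add: q(2) scaleR_diff_left sum_subtractf flip: scaleR_scaleR scaleR_sum_right uc)
    have "z \<in> conic_hull T'"
      using \<epsilon> unfolding zT' by (intro conic_hullI) (auto simp: \<mu>_def T'_def)
    then have "val T \<le> val T'" using min T'U indT' cT' by blast
    also have "val T' = \<epsilon> * h u + (\<Sum>t\<in>T. (q t - \<epsilon> * c t) * h t)"
      using val[OF indT' finT' zT'] sumT'[of h] by simp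
    also have "(\<Sum>t\<in>T. (q t - \<epsilon> * c t) * h t) = val T - \<epsilon> * (\<Sum>t\<in>T. c t * h t)"
      using val[OF ind finT q(2)] by (simp add: left_diff_distrib sum_subtractf sum_distrib_left mult.assoc)
    also have "(\<Sum>t\<in>T. c t * h t) = l u"
      by (subst uc) (simp add: linear_sum[OF l(1)] linear_cmul[OF l(1)] l(2))
    finally have "\<epsilon> * l u \<le> \<epsilon> * h u" by simp
    then show False using lu \<open>\<epsilon> > 0\<close> by simp
  qed
  \<comment> \<open>Minimality yields only the weak inequality; equality is excluded by the general
    position of the heights.\<close>
  have "l u < h u" if u: "u \<in> U - T" for u
  proof -
    have "u \<in> span T" using span by simp
    then have "l u \<noteq> h u"
      using h[unfolded generic_heights_def, rule_format, OF TU ind _ u l(1)] l(2) by blast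
    with le[OF u] show ?thesis by simp
  qed
  then have "T \<in> lower_bases U h"
    using TU ind cT l unfolding lower_bases_def by blast
  then show ?thesis using zT that by blast
qed

text \<open>The functional of a lower basis \<open>T\<close> is at most \<open>h\<close> on
  \<open>U\<close>, and strictly smaller off \<open>T\<close>. As \<open>z\<close> has positive
  coefficients on all of \<open>S\<close>, its value under the functional of \<open>T\<close> is
  strictly below that under the functional of \<open>S\<close> when the two bases differ. Exchanging
  their roles gives a contradiction.\<close>

lemma lower_basis_cone_unique:
  fixes U :: "'a::euclidean_space set"
  assumes U: "finite U" and z: "generic_point U z"
    and T: "T \<in> lower_bases U h" "z \<in> conic_hull T"
    and S: "S \<in> lower_bases U h" "z \<in> conic_hull S"
  shows "S = T"
proof (rule ccontr)
  assume "S \<noteq> T"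
  have less: "\<exists>l. linear l \<and> (\<forall>t\<in>T. l t = h t) \<and> (\<forall>l'. linear l' \<longrightarrow> (\<forall>t\<in>S. l' t = h t) \<longrightarrow> l z < l' z)"
    if "S \<noteq> T" and T: "T \<in> lower_bases U h" "z \<in> conic_hull T"
    and S: "S \<in> lower_bases U h" "z \<in> conic_hull S" for S T
  proof -
    obtain l where l: "linear l" "\<forall>t\<in>T. l t = h t" "\<forall>u\<in>U - T. l u < h u"
      using T by (auto simp: lower_bases_def)
    have SU: "S \<subseteq> U" "card S = DIM('a)" and TU: "T \<subseteq> U" "card T = DIM('a)"
      using S T by (auto simp: lower_bases_def)
    have fin: "finite S" "finite T" using SU TU U finite_subset by blast+
    obtain s where s: "s \<in> S" "s \<notin> T"
      using \<open>S \<noteq> T\<close> SU TU fin by (metis card_subset_eq subsetI)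
    obtain q where q: "\<And>u. u \<in> S \<Longrightarrow> q u \<ge> 0" "z = (\<Sum>u\<in>S. q u *\<^sub>R u)"
      using S(2) by (auto simp: conic_hull_def)
    have "q s \<noteq> 0" using generic_point_pos[OF U SU(1) _ SU(2) s(1), of q] z q(2) by simp
    then have ls: "q s > 0" using q(1)[OF s(1)] by simp
    have lz: "l' z = (\<Sum>u\<in>S. q u * l' u)" if "linear l'" for l' :: "'a \<Rightarrow> real"
      by (subst q(2)) (simp add: linear_sum[OF that] linear_cmul[OF that])
    have "l z < (\<Sum>u\<in>S. q u * h u)"
      unfolding lz[OF l(1)]
    proof (rule sum_strict_mono_ex1[OF fin(1)])
      show "\<forall>u\<in>S. q u * l u \<le> q u * h u"
        using q(1) l SU by (metis DiffI less_imp_le mult_left_mono order_refl subsetD)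
      show "\<exists>u\<in>S. q u * l u < q u * h u"
        using s ls l(3) SU by (intro bexI[of _ s]) auto
    qed
    moreover have "l' z = (\<Sum>u\<in>S. q u * h u)" if "linear l'" "\<forall>t\<in>S. l' t = h t" for l'
      unfolding lz[OF that(1)] using that(2) by (intro sum.cong) auto
    ultimately show ?thesis using l(1,2) by (intro exI[of _ l]) auto
  qed
  from less[OF \<open>S \<noteq> T\<close> T S] obtain l where l: "linear l" "\<forall>t\<in>T. l t = h t"
      "\<forall>l'. linear l' \<longrightarrow> (\<forall>t\<in>S. l' t = h t) \<longrightarrow> l z < l' z" by (elim exE conjE)
  from less[OF \<open>S \<noteq> T\<close>[symmetric] S T] obtain l' where l': "linear l'" "\<forall>t\<in>S. l' t = h t"
      "\<forall>l. linear l \<longrightarrow> (\<forall>t\<in>T. l t = h t) \<longrightarrow> l' z < l z" by (elim exE conjE)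
  from l(3)[rule_format, OF l'(1)] l'(3)[rule_format, OF l(1)] l(2) l'(2) show False by fastforce
qed

section \<open>Polynomiality of the volume of Minkowski combinations\<close>

definition minkowski_comb :: "real \<Rightarrow> 'a::real_vector set \<Rightarrow> real \<Rightarrow> 'a set \<Rightarrow> 'a set" where
  "minkowski_comb a A b B = (\<lambda>(x, y). a *\<^sub>R x + b *\<^sub>R y) ` (A \<times> B)"

lemma mem_minkowski_comb:
  "z \<in> minkowski_comb a A b B \<longleftrightarrow> (\<exists>x\<in>A. \<exists>y\<in>B. z = a *\<^sub>R x + b *\<^sub>R y)"
  by (auto simp: minkowski_comb_def)

lemma compact_minkowski_comb:
  fixes A B :: "'a::real_normed_vector set"
  assumes "compact A" "compact B" shows "compact (minkowski_comb a A b B)"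
  unfolding minkowski_comb_def case_prod_beta
  by (intro compact_continuous_image compact_Times assms continuous_intros)

lemma convex_minkowski_comb:
  assumes "convex A" "convex B" shows "convex (minkowski_comb a A b B)"
proof -
  have "linear (\<lambda>(x, y). a *\<^sub>R x + b *\<^sub>R y)"
    by (intro linearI) (auto simp: algebra_simps)
  then show ?thesis
    unfolding minkowski_comb_def by (intro convex_linear_image convex_Times assms)
qed

text \<open>By the Cayley trick the slices of the cone over this configuration are the Minkowski
  combinations of the two convex hulls, so that a triangulation of the cone into simplicial cones
  cuts all these combinations simultaneously into sums of simplices.\<close>
definition cayley :: "'a::euclidean_space set \<Rightarrow> 'a set \<Rightarrow> ('a \<times> real \<times> real) set" where
  "cayley V W = (\<lambda>v. (v, 1, 0)) ` V \<union> (\<lambda>w. (w, 0, 1)) ` W"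

lemma finite_cayley: "finite V \<Longrightarrow> finite W \<Longrightarrow> finite (cayley V W)"
  by (simp add: cayley_def)

lemma cayley_subset:
  assumes "T \<subseteq> cayley V W"
  obtains V' W' where "V' \<subseteq> V" "W' \<subseteq> W" "T = cayley V' W'"
proof
  show "{v \<in> V. (v, 1, 0) \<in> T} \<subseteq> V" "{w \<in> W. (w, 0, 1) \<in> T} \<subseteq> W" by auto
  show "T = cayley {v \<in> V. (v, 1, 0) \<in> T} {w \<in> W. (w, 0, 1) \<in> T}"
    using assms by (auto simp: cayley_def)
qed

lemma card_cayley:
  assumes "finite V" "finite W" shows "card (cayley V W) = card V + card W"
  unfolding cayley_def using assms
  by (subst card_Un_disjoint) (auto simp: card_image inj_on_def)

lemma sum_cayley:
  assumes "finite V" "finite W"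
  shows "(\<Sum>u\<in>cayley V W. f u) = (\<Sum>v\<in>V. f (v, 1, 0)) + (\<Sum>w\<in>W. f (w, 0, 1))"
  unfolding cayley_def using assms
  by (subst sum.union_disjoint) (auto simp: sum.reindex inj_on_def)

lemma sum_scaleR_cayley:
  assumes "finite V" "finite W"
  shows "(\<Sum>u\<in>cayley V W. q u *\<^sub>R u)
    = ((\<Sum>v\<in>V. q (v, 1, 0) *\<^sub>R v) + (\<Sum>w\<in>W. q (w, 0, 1) *\<^sub>R w),
       (\<Sum>v\<in>V. q (v, 1, 0)), (\<Sum>w\<in>W. q (w, 0, 1)))"
  by (simp add: sum_cayley[OF assms] prod_eq_iff fst_sum snd_sum)

lemma convex_hull_scaled:
  assumes "finite S" "a > 0"
  shows "(\<exists>x\<in>convex hull S. z = a *\<^sub>R x) \<longleftrightarrow>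
    (\<exists>p. (\<forall>v\<in>S. p v \<ge> 0) \<and> sum p S = a \<and> z = (\<Sum>v\<in>S. p v *\<^sub>R v))"
proof
  assume "\<exists>x\<in>convex hull S. z = a *\<^sub>R x"
  then obtain u where "\<forall>v\<in>S. u v \<ge> 0" "sum u S = 1" "z = a *\<^sub>R (\<Sum>v\<in>S. u v *\<^sub>R v)"
    by (auto simp: convex_hull_finite[OF assms(1)])
  then show "\<exists>p. (\<forall>v\<in>S. p v \<ge> 0) \<and> sum p S = a \<and> z = (\<Sum>v\<in>S. p v *\<^sub>R v)"
    using assms(2) by (intro exI[of _ "\<lambda>v. a * u v"]) (auto simp: scaleR_sum_right sum_distrib_left[symmetric])
next
  assume "\<exists>p. (\<forall>v\<in>S. p v \<ge> 0) \<and> sum p S = a \<and> z = (\<Sum>v\<in>S. p v *\<^sub>R v)"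
  then obtain p where p: "\<forall>v\<in>S. p v \<ge> 0" "sum p S = a" "z = (\<Sum>v\<in>S. p v *\<^sub>R v)" by blast
  have "(\<Sum>v\<in>S. (p v / a) *\<^sub>R v) \<in> convex hull S"
    using p assms unfolding convex_hull_finite[OF assms(1)]
    by (intro CollectI exI[of _ "\<lambda>v. p v / a"]) (auto simp: sum_divide_distrib[symmetric])
  moreover have "z = a *\<^sub>R (\<Sum>v\<in>S. (p v / a) *\<^sub>R v)"
    using p assms by (simp add: scaleR_sum_right)
  ultimately show "\<exists>x\<in>convex hull S. z = a *\<^sub>R x" by blast
qed

text \<open>The last two coordinates of a conic combination record the total weights on
  \<open>V\<close> and on \<open>W\<close>. At height (a, b) these totals are a and b, and dividing
  by them, which takes positive a and b, turns the two groups of weights into convex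
  combinations.\<close>

lemma cayley_slice:
  assumes fin: "finite V" "finite W" and ab: "a > 0" "b > 0"
  shows "(x, a, b) \<in> conic_hull (cayley V W) \<longleftrightarrow>
    x \<in> minkowski_comb a (convex hull V) b (convex hull W)"
proof -
  have "(x, a, b) \<in> conic_hull (cayley V W) \<longleftrightarrow>
    (\<exists>q :: 'a \<times> real \<times> real \<Rightarrow> real. (\<forall>v\<in>V. q (v, 1, 0) \<ge> (0::real)) \<and> (\<forall>w\<in>W. q (w, 0, 1) \<ge> 0) \<and>
       x = (\<Sum>v\<in>V. q (v, 1, 0) *\<^sub>R v) + (\<Sum>w\<in>W. q (w, 0, 1) *\<^sub>R w) \<and>
       a = (\<Sum>v\<in>V. q (v, 1, 0)) \<and> b = (\<Sum>w\<in>W. q (w, 0, 1 :: real)))"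
  proof -
    have "(\<forall>u\<in>cayley V W. q u \<ge> (0::real)) \<longleftrightarrow> (\<forall>v\<in>V. q (v, 1, 0) \<ge> 0) \<and> (\<forall>w\<in>W. q (w, 0, 1) \<ge> 0)"
      for q :: "'a \<times> real \<times> real \<Rightarrow> real"
      by (auto simp: cayley_def)
    then show ?thesis
      unfolding conic_hull_def sum_scaleR_cayley[OF fin] by simp
  qed
  also have "\<dots> \<longleftrightarrow> (\<exists>p r. (\<forall>v\<in>V. p v \<ge> 0) \<and> (\<forall>w\<in>W. r w \<ge> 0) \<and>
       x = (\<Sum>v\<in>V. p v *\<^sub>R v) + (\<Sum>w\<in>W. r w *\<^sub>R w) \<and> a = sum p V \<and> b = sum r W)"
  proof safe
    fix p r :: "'a \<Rightarrow> real"
    assume "\<forall>v\<in>V. p v \<ge> 0" "\<forall>w\<in>W. r w \<ge> 0"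
    then show "\<exists>q :: 'a \<times> real \<times> real \<Rightarrow> real. (\<forall>v\<in>V. q (v, 1, 0) \<ge> (0::real)) \<and> (\<forall>w\<in>W. q (w, 0, 1) \<ge> 0) \<and>
       (\<Sum>v\<in>V. p v *\<^sub>R v) + (\<Sum>w\<in>W. r w *\<^sub>R w) = (\<Sum>v\<in>V. q (v, 1, 0) *\<^sub>R v) + (\<Sum>w\<in>W. q (w, 0, 1) *\<^sub>R w) \<and>
       sum p V = (\<Sum>v\<in>V. q (v, 1, 0)) \<and> sum r W = (\<Sum>w\<in>W. q (w, 0, 1 :: real))"
      by (intro exI[of _ "\<lambda>(y, s, t). if s = 1 then p y else r y"]) auto
  next
    fix q :: "'a \<times> real \<times> real \<Rightarrow> real"
    assume "\<forall>v\<in>V. q (v, 1, 0) \<ge> 0" "\<forall>w\<in>W. q (w, 0, 1) \<ge> 0"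
    then show "\<exists>p r. (\<forall>v\<in>V. p v \<ge> 0) \<and> (\<forall>w\<in>W. r w \<ge> 0) \<and>
       (\<Sum>v\<in>V. q (v, 1, 0) *\<^sub>R v) + (\<Sum>w\<in>W. q (w, 0, 1) *\<^sub>R w) = (\<Sum>v\<in>V. p v *\<^sub>R v) + (\<Sum>w\<in>W. r w *\<^sub>R w) \<and>
       (\<Sum>v\<in>V. q (v, 1, 0)) = sum p V \<and> (\<Sum>w\<in>W. q (w, 0, 1)) = sum r W"
      by (intro exI[of _ "\<lambda>v. q (v, 1, 0)"] exI[of _ "\<lambda>w. q (w, 0, 1)"]) auto
  qed
  also have "\<dots> \<longleftrightarrow> (\<exists>y z. (\<exists>p. (\<forall>v\<in>V. p v \<ge> 0) \<and> sum p V = a \<and> y = (\<Sum>v\<in>V. p v *\<^sub>R v)) \<and>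
      (\<exists>r. (\<forall>w\<in>W. r w \<ge> 0) \<and> sum r W = b \<and> z = (\<Sum>w\<in>W. r w *\<^sub>R w)) \<and> x = y + z)"
    (is "?L \<longleftrightarrow> ?R")
  proof
    assume ?L
    then obtain p r where pr: "\<forall>v\<in>V. p v \<ge> 0" "\<forall>w\<in>W. r w \<ge> 0" "a = sum p V" "b = sum r W"
      "x = (\<Sum>v\<in>V. p v *\<^sub>R v) + (\<Sum>w\<in>W. r w *\<^sub>R w)" by blast
    have "\<exists>p'. (\<forall>v\<in>V. p' v \<ge> 0) \<and> sum p' V = a \<and> (\<Sum>v\<in>V. p v *\<^sub>R v) = (\<Sum>v\<in>V. p' v *\<^sub>R v)"
      using pr by (intro exI[of _ p]) simp
    moreover have "\<exists>r'. (\<forall>w\<in>W. r' w \<ge> 0) \<and> sum r' W = b \<and> (\<Sum>w\<in>W. r w *\<^sub>R w) = (\<Sum>w\<in>W. r' w *\<^sub>R w)"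
      using pr by (intro exI[of _ r]) simp
    ultimately show ?R using pr(5) by blast
  next
    assume ?R
    then obtain y z p r where "\<forall>v\<in>V. p v \<ge> 0" "sum p V = a" "y = (\<Sum>v\<in>V. p v *\<^sub>R v)"
      "\<forall>w\<in>W. r w \<ge> 0" "sum r W = b" "z = (\<Sum>w\<in>W. r w *\<^sub>R w)" "x = y + z" by (elim exE conjE)
    then show ?L by (intro exI[of _ p] exI[of _ r]) simp
  qed
  also have "\<dots> \<longleftrightarrow> x \<in> minkowski_comb a (convex hull V) b (convex hull W)"
    unfolding convex_hull_scaled[OF fin(1) ab(1), symmetric] convex_hull_scaled[OF fin(2) ab(2), symmetric]
    by (auto simp: mem_minkowski_comb)
  finally show ?thesis .
qed

section \<open>Volumes of the cells and of combinations of polytopes\<close>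

lemma measure_lebesgue_compact:
  fixes S :: "'a::euclidean_space set"
  shows "compact S \<Longrightarrow> measure lebesgue S = measure lborel S"
  by (simp add: measure_def borel_compact)

text \<open>By the count of vectors, the hulls of \<open>V\<close> and \<open>W\<close> are
  simplices whose edge directions at one vertex each, \<open>B1\<close> and \<open>B2\<close>,
  together form a basis of the space. Up to a translation, the combination with coefficients a, b is
  the image of the one with coefficients 1, 1 under the map \<open>D\<close> that multiplies by a on
  the span of \<open>B1\<close> and by b on the span of \<open>B2\<close>. Its volume factor is a
  power of a times a power of b.\<close>

lemma measure_simplex_sum:
  fixes V W :: "'a::euclidean_space set"
  assumes fin: "finite V" "finite W"
    and ind: "independent (cayley V W)" and card: "card (cayley V W) = DIM('a) + 2"
  obtains c k where "c \<ge> 0" "k \<le> DIM('a)"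
    "\<And>a b. a > 0 \<Longrightarrow> b > 0 \<Longrightarrow>
       measure lebesgue (minkowski_comb a (convex hull V) b (convex hull W)) = c * a ^ k * b ^ (DIM('a) - k)"
proof -
  have span: "span (cayley V W) = UNIV"
    using ind card dim_eq_card[OF refl ind] by (simp flip: dim_eq_full)
  have ex: "\<exists>q :: 'a \<times> real \<times> real \<Rightarrow> real. y = ((\<Sum>v\<in>V. q (v, 1, 0) *\<^sub>R v) + (\<Sum>w\<in>W. q (w, 0, 1) *\<^sub>R w),
       (\<Sum>v\<in>V. q (v, 1, 0)), (\<Sum>w\<in>W. q (w, 0, 1)))" for y :: "'a \<times> real \<times> real"
  proof -
    have "y \<in> range (\<lambda>q. \<Sum>u\<in>cayley V W. q u *\<^sub>R u)"
      using span span_finite[OF finite_cayley[OF fin]] by auto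
    then obtain q where "y = (\<Sum>u\<in>cayley V W. q u *\<^sub>R u)" by blast
    then show ?thesis by (intro exI[of _ q]) (simp add: sum_scaleR_cayley[OF fin])
  qed
  have "V \<noteq> {}" using ex[of "(0, 1, 0)"] by auto
  then obtain v0 where v0: "v0 \<in> V" by blast
  have "W \<noteq> {}" using ex[of "(0, 0, 1)"] by auto
  then obtain w0 where w0: "w0 \<in> W" by blast
  define B1 where "B1 = (\<lambda>v. v - v0) ` (V - {v0})"
  define B2 where "B2 = (\<lambda>w. w - w0) ` (W - {w0})"
  have finB: "finite B1" "finite B2" using fin by (auto simp: B1_def B2_def)
  have in1: "v - v0 \<in> span B1" if "v \<in> V" for v
    using that by (cases "v = v0") (auto simp: B1_def span_zero intro!: span_base)
  have in2: "w - w0 \<in> span B2" if "w \<in> W" for w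
    using that by (cases "w = w0") (auto simp: B2_def span_zero intro!: span_base)
  have spanB: "span (B1 \<union> B2) = UNIV"
  proof (intro set_eqI iffI UNIV_I)
    fix x :: 'a
    obtain q :: "'a \<times> real \<times> real \<Rightarrow> real" where q: "x = (\<Sum>v\<in>V. q (v, 1, 0) *\<^sub>R v) + (\<Sum>w\<in>W. q (w, 0, 1) *\<^sub>R w)"
       "(\<Sum>v\<in>V. q (v, 1, 0)) = 0" "(\<Sum>w\<in>W. q (w, 0, 1)) = 0"
      using ex[of "(x, 0, 0)"] by auto
    \<comment> \<open>The weights over \<open>V\<close> and those over \<open>W\<close> each sum to
      0, so the base points may be subtracted for free.\<close>
    have "x = (\<Sum>v\<in>V. q (v, 1, 0) *\<^sub>R (v - v0)) + (\<Sum>w\<in>W. q (w, 0, 1) *\<^sub>R (w - w0))"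
      using q by (simp add: scaleR_diff_right sum_subtractf flip: scaleR_sum_left)
    also have "\<dots> \<in> span (B1 \<union> B2)"
    proof (intro span_add span_sum span_scale)
      show "v - v0 \<in> span (B1 \<union> B2)" if "v \<in> V" for v
        using in1[OF that] span_mono[of B1 "B1 \<union> B2"] by blast
      show "w - w0 \<in> span (B1 \<union> B2)" if "w \<in> W" for w
        using in2[OF that] span_mono[of B2 "B1 \<union> B2"] by blast
    qed
    finally show "x \<in> span (B1 \<union> B2)" .
  qed
  have cards: "card V + card W = DIM('a) + 2" "card V > 0" "card W > 0"
    using card card_cayley[OF fin] fin v0 w0 by (auto simp: card_gt_0_iff)
  have c1: "card B1 \<le> card V - 1" "card B2 \<le> card W - 1"
    unfolding B1_def B2_def using fin v0 w0 by (metis card_image_le card_Diff_singleton finite_Diff)+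
  \<comment> \<open>A squeeze: a spanning set has at least \<open>DIM('a)\<close> elements, while
    the cardinalities of \<open>B1\<close> and \<open>B2\<close> add up to at most
    \<open>DIM('a)\<close>. So both bounds are attained and the two sets are disjoint.\<close>
  have "DIM('a) \<le> card (B1 \<union> B2)"
    using dim_le_card[of UNIV "B1 \<union> B2"] spanB finB by (simp add: dim_UNIV)
  moreover have cUn: "card (B1 \<union> B2) + card (B1 \<inter> B2) = card B1 + card B2"
    using card_Un_Int[OF finB] by simp
  ultimately have cB: "card (B1 \<union> B2) = DIM('a)" "card B1 = card V - 1" "card B2 = card W - 1" "card (B1 \<inter> B2) = 0"
    using c1 cards by linarith+
  then have disj: "B1 \<inter> B2 = {}" using finB by simp
  have indB: "independent (B1 \<union> B2)"
    using spanB finB cB(1) by (intro card_le_dim_spanning[of _ UNIV]) (auto simp: dim_UNIV)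
  define X where "X = minkowski_comb 1 ((+) (- v0) ` (convex hull V)) 1 ((+) (- w0) ` (convex hull W))"
  have comX: "compact X"
    unfolding X_def using fin
    by (intro compact_minkowski_comb compact_translation finite_imp_compact_convex_hull)
  show ?thesis
  proof (rule that[of "measure lborel X" "card V - 1"])
    show "card V - 1 \<le> DIM('a)" using cards by linarith
    fix a b :: real assume ab: "a > 0" "b > 0"
    define s where "s v = (if v \<in> B1 then a else b)" for v
    obtain D :: "'a \<Rightarrow> 'a" where D: "linear D" "\<And>v. v \<in> B1 \<union> B2 \<Longrightarrow> D v = s v *\<^sub>R v"
      using linear_independent_extend[OF indB, of "\<lambda>v. s v *\<^sub>R v"] by blast
    have D1: "D y = a *\<^sub>R y" if "y \<in> span B1" for y
      using D that by (intro linear_eq_on[OF D(1) _ that]) (auto simp: s_def intro!: linearI simp: algebra_simps)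
    have D2: "D y = b *\<^sub>R y" if "y \<in> span B2" for y
      using D disj that
      by (intro linear_eq_on[OF D(1) _ that]) (auto simp: s_def intro!: linearI simp: algebra_simps)
    have hull1: "y - v0 \<in> span B1" if "y \<in> convex hull V" for y
    proof -
      have "convex hull V \<subseteq> (+) v0 ` span B1"
        using in1 by (intro hull_minimal convex_translation subspace_imp_convex subspace_span)
          (force intro!: image_eqI[of _ _ "_ - v0"])
      then show ?thesis using that by auto
    qed
    have hull2: "y - w0 \<in> span B2" if "y \<in> convex hull W" for y
    proof -
      have "convex hull W \<subseteq> (+) w0 ` span B2"
        using in2 by (intro hull_minimal convex_translation subspace_imp_convex subspace_span)
          (force intro!: image_eqI[of _ _ "_ - w0"])
      then show ?thesis using that by auto
    qed
    have "minkowski_comb a (convex hull V) b (convex hull W) = (\<lambda>(x, y). a *\<^sub>R x + b *\<^sub>R y) ` ((convex hull V) \<times> (convex hull W))"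
      by (simp add: minkowski_comb_def)
    also have "\<dots> = (\<lambda>(x, y). (a *\<^sub>R v0 + b *\<^sub>R w0) + D ((x - v0) + (y - w0))) ` ((convex hull V) \<times> (convex hull W))"
    proof (intro image_cong refl, clarify)
      fix x y assume "x \<in> convex hull V" "y \<in> convex hull W"
      then have "D ((x - v0) + (y - w0)) = a *\<^sub>R (x - v0) + b *\<^sub>R (y - w0)"
        using D1[OF hull1] D2[OF hull2] by (subst linear_add[OF D(1)]) simp
      then show "a *\<^sub>R x + b *\<^sub>R y = (a *\<^sub>R v0 + b *\<^sub>R w0) + D ((x - v0) + (y - w0))"
        by (simp only:) (simp add: algebra_simps)
    qed
    also have "\<dots> = (+) (a *\<^sub>R v0 + b *\<^sub>R w0) ` (D ` X)"
      unfolding X_def minkowski_comb_def by (force simp: image_iff)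
    finally have "measure lebesgue (minkowski_comb a (convex hull V) b (convex hull W))
        = measure lebesgue (D ` X)" by (simp add: measure_translation)
    also have "\<dots> = measure lborel (D ` X)"
      using comX D(1) by (intro measure_lebesgue_compact compact_continuous_image linear_continuous_on)
        (simp_all add: linear_conv_bounded_linear)
    also have "\<dots> = (\<Prod>v\<in>B1 \<union> B2. s v) * measure lborel X"
    proof -
      have "emeasure lborel (D ` X) = ennreal (\<Prod>v\<in>B1 \<union> B2. s v) * emeasure lborel X"
        using comX ab by (intro emeasure_lborel_basis_scaling indB spanB D) (auto simp: s_def borel_compact)
      moreover have "(\<Prod>v\<in>B1 \<union> B2. s v) \<ge> 0"
        using ab by (intro prod_nonneg) (auto simp: s_def)
      ultimately show ?thesis by (simp add: measure_def enn2real_mult)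
    qed
    also have "(\<Prod>v\<in>B1 \<union> B2. s v) = (\<Prod>v\<in>B1. s v) * (\<Prod>v\<in>B2. s v)"
      by (rule prod.union_disjoint[OF finB disj])
    also have "(\<Prod>v\<in>B1. s v) = a ^ (card V - 1)"
      by (simp add: s_def cB)
    also have "(\<Prod>v\<in>B2. s v) = (\<Prod>v\<in>B2. b)"
      using disj by (intro prod.cong) (auto simp: s_def)
    also have "\<dots> = b ^ (DIM('a) - (card V - 1))"
    proof -
      have "card W - 1 = DIM('a) - (card V - 1)" using cards by linarith
      then show ?thesis by (simp only: prod_constant cB(3))
    qed
    finally show "measure lebesgue (minkowski_comb a (convex hull V) b (convex hull W)) =
       measure lborel X * a ^ (card V - 1) * b ^ (DIM('a) - (card V - 1))" by (simp add: ac_simps)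
  qed simp
qed

text \<open>The span of too few generators meets the slice at height (a, b) in a translate of a
  subspace \<open>Y\<close>, or not at all. As a and b are positive, a nonempty intersection forces
  generators of both kinds into \<open>S\<close>. If \<open>Y\<close> were everything, these two
  would make \<open>S\<close> span the ambient space, against its cardinality.\<close>

lemma negligible_not_generic_slice:
  fixes V W :: "'a::euclidean_space set"
  assumes fin: "finite V" "finite W" and ab: "a > 0" "b > 0"
  shows "negligible {x. \<not> generic_point (cayley V W) (x, a, b)}"
proof -
  let ?U = "cayley V W"
  have "negligible {x. (x, a, b) \<in> span S}" if S: "S \<subseteq> ?U" "card S < DIM('a) + 2" for S
  proof (cases "{x. (x, a, b) \<in> span S} = {}")
    case False
    then obtain x0 where x0: "(x0, a, b) \<in> span S" by blast
    define Y where "Y = {y::'a. (y, 0, 0) \<in> span S}"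
    have "subspace Y"
      unfolding Y_def subspace_def
      using span_zero[of S] span_add[of _ S] span_scale[of _ S] by (force simp: zero_prod_def)
    have "Y \<noteq> UNIV"
    proof
      assume Y: "Y = UNIV"
      have ex: "\<exists>v. (v, 1, 0) \<in> S"
      proof (rule ccontr)
        assume "\<not> ?thesis"
        then have "S \<subseteq> {u. fst (snd u) = 0}" using S(1) by (auto simp: cayley_def)
        moreover have "subspace {u::'a \<times> real \<times> real. fst (snd u) = 0}" by (auto simp: subspace_def)
        ultimately have "span S \<subseteq> {u. fst (snd u) = 0}" by (rule span_minimal)
        then show False using x0 ab by auto
      qed
      have ex': "\<exists>w. (w, 0, 1) \<in> S"
      proof (rule ccontr)
        assume "\<not> ?thesis"
        then have "S \<subseteq> {u. snd (snd u) = 0}" using S(1) by (auto simp: cayley_def)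
        moreover have "subspace {u::'a \<times> real \<times> real. snd (snd u) = 0}" by (auto simp: subspace_def)
        ultimately have "span S \<subseteq> {u. snd (snd u) = 0}" by (rule span_minimal)
        then show False using x0 ab by auto
      qed
      obtain v w where v: "(v, 1, 0) \<in> S" and w: "(w, 0, 1) \<in> S" using ex ex' by blast
      have "(x, s, t) \<in> span S" for x s t
      proof -
        have "(x - s *\<^sub>R v - t *\<^sub>R w, 0, 0) \<in> span S" using Y by (auto simp: Y_def)
        then have "(x - s *\<^sub>R v - t *\<^sub>R w, 0, 0) + s *\<^sub>R (v, 1, 0) + t *\<^sub>R (w, 0, 1) \<in> span S"
          by (intro span_add span_scale[OF span_base[OF v]] span_scale[OF span_base[OF w]])
        then show ?thesis by simp
      qed
      then have "span S = UNIV" by auto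
      moreover have "finite S" using S(1) finite_cayley[OF fin] finite_subset by blast
      ultimately have "DIM('a \<times> real \<times> real) \<le> card S"
        using dim_le_card[of UNIV S] by (simp add: dim_UNIV)
      then show False using S(2) by simp
    qed
    then have "dim Y < DIM('a)"
      using \<open>subspace Y\<close> by (metis dim_eq_full dim_subset_UNIV le_neq_implies_less span_eq_iff)
    then have "negligible ((+) x0 ` Y)"
      by (intro negligible_translation negligible_lowdim)
    moreover have "{x. (x, a, b) \<in> span S} \<subseteq> (+) x0 ` Y"
    proof
      fix x assume "x \<in> {x. (x, a, b) \<in> span S}"
      then have "(x, a, b) - (x0, a, b) \<in> span S" using x0 by (intro span_diff) auto
      then have "x - x0 \<in> Y" by (simp add: Y_def zero_prod_def)
      then show "x \<in> (+) x0 ` Y" by (intro image_eqI[of _ _ "x - x0"]) auto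
    qed
    ultimately show ?thesis by (rule negligible_subset)
  qed simp
  then have "negligible (\<Union>S\<in>{S. S \<subseteq> ?U \<and> card S < DIM('a) + 2}. {x. (x, a, b) \<in> span S})"
    using finite_cayley[OF fin] by (intro negligible_Union) auto
  then show ?thesis
    by (rule negligible_subset) (auto simp: generic_point_def)
qed

text \<open>The cones over the lower bases do not depend on a and b, and their slices tile every
  combination up to null sets. Each cell contributes a single monomial with a nonnegative factor;
  the coefficient with index i collects the cells whose monomial has degree i in a.\<close>

lemma minkowski_polynomial_polytope:
  fixes V W :: "'a::euclidean_space set"
  assumes fin: "finite V" "finite W"
  obtains C where "\<And>k. C k \<ge> (0::real)"
    "\<And>a b. a > 0 \<Longrightarrow> b > 0 \<Longrightarrow>
       measure lebesgue (minkowski_comb a (convex hull V) b (convex hull W))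
         = (\<Sum>k\<le>DIM('a). C k * a ^ k * b ^ (DIM('a) - k))"
proof -
  let ?U = "cayley V W"
  have finU: "finite ?U" by (rule finite_cayley[OF fin])
  obtain h where h: "generic_heights ?U h" by (rule generic_heights_exist[OF finU])
  let ?L = "lower_bases ?U h"
  have finL: "finite ?L"
    by (rule finite_subset[of _ "Pow ?U"]) (use finU in \<open>auto simp: lower_bases_def\<close>)
  define sl where "sl a b T = {x. (x, a, b) \<in> conic_hull T}" for a b :: real and T :: "('a \<times> real \<times> real) set"
  \<comment> \<open>The sum of the two heights places all generators on one affine hyperplane, as
    the existence of lower bases demands.\<close>
  define \<sigma> :: "'a \<times> real \<times> real \<Rightarrow> real" where "\<sigma> u = fst (snd u) + snd (snd u)" for u
  have \<sigma>: "linear \<sigma>" by (intro linearI) (auto simp: \<sigma>_def algebra_simps)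
  have \<sigma>1: "\<sigma> u = 1" if "u \<in> ?U" for u using that by (auto simp: cayley_def \<sigma>_def)
  have ex: "\<exists>c k. c \<ge> 0 \<and> k \<le> DIM('a) \<and> (\<forall>a b. a > 0 \<longrightarrow> b > 0 \<longrightarrow>
      sl a b T \<in> lmeasurable \<and> measure lebesgue (sl a b T) = c * a ^ k * b ^ (DIM('a) - k))" if "T \<in> ?L" for T
  proof -
    have T: "T \<subseteq> ?U" "independent T" "card T = DIM('a) + 2"
      using that by (auto simp: lower_bases_def)
    obtain V' W' where VW: "V' \<subseteq> V" "W' \<subseteq> W" "T = cayley V' W'"
      by (rule cayley_subset[OF T(1)])
    have fin': "finite V'" "finite W'" using VW fin finite_subset by blast+
    have sl: "sl a b T = minkowski_comb a (convex hull V') b (convex hull W')" if "a > 0" "b > 0" for a b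
      using cayley_slice[OF fin' that] by (auto simp: sl_def VW(3))
    have "sl a b T \<in> lmeasurable" if "a > 0" "b > 0" for a b
      unfolding sl[OF that] using fin'
      by (intro lmeasurable_compact compact_minkowski_comb finite_imp_compact_convex_hull)
    moreover obtain c k where "c \<ge> 0" "k \<le> DIM('a)"
      "\<And>a b. a > 0 \<Longrightarrow> b > 0 \<Longrightarrow>
         measure lebesgue (minkowski_comb a (convex hull V') b (convex hull W')) = c * a ^ k * b ^ (DIM('a) - k)"
      using measure_simplex_sum[OF fin'] T VW(3) by metis
    ultimately show ?thesis using sl by (intro exI[of _ c] exI[of _ k]) auto
  qed
  obtain c k where ck: "\<And>T. T \<in> ?L \<Longrightarrow> c T \<ge> 0" "\<And>T. T \<in> ?L \<Longrightarrow> k T \<le> DIM('a)"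
    "\<And>T a b. T \<in> ?L \<Longrightarrow> a > 0 \<Longrightarrow> b > 0 \<Longrightarrow> sl a b T \<in> lmeasurable"
    "\<And>T a b. T \<in> ?L \<Longrightarrow> a > 0 \<Longrightarrow> b > 0 \<Longrightarrow> measure lebesgue (sl a b T) = c T * a ^ k T * b ^ (DIM('a) - k T)"
  proof -
    have "\<forall>T\<in>?L. \<exists>ck. fst ck \<ge> 0 \<and> snd ck \<le> DIM('a) \<and> (\<forall>a b. a > 0 \<longrightarrow> b > 0 \<longrightarrow>
        sl a b T \<in> lmeasurable \<and> measure lebesgue (sl a b T) = fst ck * a ^ snd ck * b ^ (DIM('a) - snd ck))"
      using ex by (simp add: split_paired_Ex)
    from bchoice[OF this] obtain f where f: "\<forall>T\<in>?L. fst (f T) \<ge> 0 \<and> snd (f T) \<le> DIM('a) \<and> (\<forall>a b. a > 0 \<longrightarrow> b > 0 \<longrightarrow>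
        sl a b T \<in> lmeasurable \<and> measure lebesgue (sl a b T) = fst (f T) * a ^ snd (f T) * b ^ (DIM('a) - snd (f T)))" ..
    show ?thesis by (rule that[of "fst \<circ> f" "snd \<circ> f"]) (use f in auto)
  qed
  show ?thesis
  proof (rule that[of "\<lambda>i. \<Sum>T\<in>{T \<in> ?L. k T = i}. c T"])
    show "0 \<le> (\<Sum>T\<in>{T \<in> ?L. k T = i}. c T)" for i using ck(1) by (intro sum_nonneg) auto
    fix a b :: real assume ab: "a > 0" "b > 0"
    have gen: "negligible {x. \<not> generic_point ?U (x, a, b)}"
      by (rule negligible_not_generic_slice[OF fin ab])
    have cov: "\<exists>T\<in>?L. x \<in> sl a b T"
      if "x \<in> minkowski_comb a (convex hull V) b (convex hull W)"
        and gx: "generic_point ?U (x, a, b)" for x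
    proof -
      have cx: "(x, a, b) \<in> conic_hull ?U" using that cayley_slice[OF fin ab] by blast
      obtain T where "T \<in> ?L" "(x, a, b) \<in> conic_hull T"
        by (rule lower_basis_cone_exists[OF finU \<sigma> \<sigma>1 h cx gx])
      then show ?thesis by (auto simp: sl_def)
    qed
    have sub: "sl a b T \<subseteq> minkowski_comb a (convex hull V) b (convex hull W)" if "T \<in> ?L" for T
      using conic_hull_mono[OF finU, of T] that cayley_slice[OF fin ab] by (auto simp: sl_def lower_bases_def)
    have "measure lebesgue (minkowski_comb a (convex hull V) b (convex hull W))
        = measure lebesgue (\<Union>T\<in>?L. sl a b T)"
    proof (rule measure_negligible_symdiff)
      show "(\<Union>T\<in>?L. sl a b T) \<in> lmeasurable"
        using finL ck(3)[OF _ ab] by (intro fmeasurable.finite_UN) auto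
      show "negligible ((\<Union>T\<in>?L. sl a b T) - minkowski_comb a (convex hull V) b (convex hull W) \<union>
         (minkowski_comb a (convex hull V) b (convex hull W) - (\<Union>T\<in>?L. sl a b T)))"
        by (rule negligible_subset[OF gen]) (use cov sub in blast)
    qed
    also have "\<dots> = (\<Sum>T\<in>?L. measure lebesgue (sl a b T))"
    proof (rule measure_negligible_finite_Union_image[OF finL])
      show "pairwise (\<lambda>T S. negligible (sl a b T \<inter> sl a b S)) ?L"
      proof (rule pairwiseI)
        fix T S assume TS: "T \<in> ?L" "S \<in> ?L" "T \<noteq> S"
        show "negligible (sl a b T \<inter> sl a b S)"
          by (rule negligible_subset[OF gen])
             (use lower_basis_cone_unique[OF finU _ TS(1) _ TS(2)] TS(3) in \<open>auto simp: sl_def\<close>)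
      qed
    qed (use ck ab in auto)
    also have "\<dots> = (\<Sum>T\<in>?L. c T * a ^ k T * b ^ (DIM('a) - k T))"
      using ck(4) ab by (intro sum.cong) auto
    also have "\<dots> = (\<Sum>i\<le>DIM('a). \<Sum>T\<in>{T \<in> ?L. k T = i}. c T * a ^ k T * b ^ (DIM('a) - k T))"
      using ck(2) by (intro sum.group[symmetric] finL) auto
    also have "\<dots> = (\<Sum>i\<le>DIM('a). (\<Sum>T\<in>{T \<in> ?L. k T = i}. c T) * a ^ i * b ^ (DIM('a) - i))"
      by (intro sum.cong) (auto simp: sum_distrib_right)
    finally show "measure lebesgue (minkowski_comb a (convex hull V) b (convex hull W)) = \<dots>" .
  qed
qed

section \<open>From polytopes to compact convex bodies\<close>

lemma measure_eq_of_convex_dense: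
  fixes S K :: "'a::euclidean_space set"
  assumes "convex S" "S \<subseteq> K" "K \<subseteq> closure S" "compact K"
  shows "measure lebesgue S = measure lebesgue K"
proof (rule measure_negligible_symdiff)
  show "K \<in> lmeasurable" using assms(4) by (rule lmeasurable_compact)
  \<comment> \<open>\<open>K\<close> lies between \<open>S\<close> and its closure, so the
    difference sits in the frontier, and the frontier of a convex set is null.\<close>
  have "K - S \<union> (S - K) \<subseteq> frontier S"
  proof
    fix x assume "x \<in> K - S \<union> (S - K)"
    then have "x \<in> closure S" "x \<notin> S" using assms by auto
    then show "x \<in> frontier S" using interior_subset by (auto simp: frontier_def)
  qed
  then show "negligible (K - S \<union> (S - K))"
    using negligible_convex_frontier[OF assms(1)] negligible_subset by blast
qed

lemma finite_exhaustion:
  fixes A :: "'a::euclidean_space set"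
  assumes "A \<noteq> {}"
  obtains V :: "nat \<Rightarrow> 'a set" where "\<forall>m. finite (V m)" "mono V" "\<forall>m. V m \<subseteq> A" "A \<subseteq> closure (\<Union>m. V m)"
proof -
  obtain D where D: "countable D" "D \<subseteq> A" "A \<subseteq> closure D" by (rule separable)
  have "D \<noteq> {}" using D assms by auto
  show ?thesis
  proof (rule that[of "\<lambda>m. from_nat_into D ` {..m}"])
    show "mono (\<lambda>m. from_nat_into D ` {..m})" by (intro monoI image_mono) auto
    show "\<forall>m. from_nat_into D ` {..m} \<subseteq> A" using from_nat_into[OF \<open>D \<noteq> {}\<close>] D by auto
    have "(\<Union>m. from_nat_into D ` {..m}) = range (from_nat_into D)" by auto
    also have "\<dots> = D" using \<open>D \<noteq> {}\<close> D(1) by (rule range_from_nat_into)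
    finally show "A \<subseteq> closure (\<Union>m. from_nat_into D ` {..m})" using D by simp
  qed simp
qed

lemma convex_Union_mono:
  assumes "\<And>m::nat. convex (S m)" "mono S" shows "convex (\<Union>m. S m)"
proof (rule convexI)
  fix x y and u v :: real
  assume "x \<in> (\<Union>m. S m)" "y \<in> (\<Union>m. S m)" and uv: "u \<ge> 0" "v \<ge> 0" "u + v = 1"
  then obtain i k where "x \<in> S i" "y \<in> S k" by auto
  then have "x \<in> S (max i k)" "y \<in> S (max i k)"
    using monoD[OF assms(2), of i "max i k"] monoD[OF assms(2), of k "max i k"] by auto
  then have "u *\<^sub>R x + v *\<^sub>R y \<in> S (max i k)" using convexD[OF assms(1)] uv by blast
  then show "u *\<^sub>R x + v *\<^sub>R y \<in> (\<Union>m. S m)" by blast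
qed

lemma minkowski_comb_mono:
  "A \<subseteq> A' \<Longrightarrow> B \<subseteq> B' \<Longrightarrow> minkowski_comb a A b B \<subseteq> minkowski_comb a A' b B'"
  by (auto simp: minkowski_comb_def)

text \<open>The combinations of the finite hulls increase to a convex set that is dense in the full
  combination but need not exhaust it; the missing points lie on its frontier and carry no
  volume.\<close>

lemma measure_minkowski_comb_exhaustion:
  fixes A B :: "'a::euclidean_space set"
  assumes A: "compact A" "convex A" and B: "compact B" "convex B"
    and V: "mono V" "\<And>m::nat. V m \<subseteq> A" "A \<subseteq> closure (\<Union>m. V m)"
    and W: "mono W" "\<And>m::nat. W m \<subseteq> B" "B \<subseteq> closure (\<Union>m. W m)"
  shows "(\<lambda>m. measure lebesgue (minkowski_comb a (convex hull V m) b (convex hull W m)))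
    \<longlonglongrightarrow> measure lebesgue (minkowski_comb a A b B)"
proof -
  define S where "S m = minkowski_comb a (convex hull V m) b (convex hull W m)" for m
  have hV: "convex hull V m \<subseteq> A" for m by (rule hull_minimal[of _ _ convex, OF V(2) A(2)])
  have hW: "convex hull W m \<subseteq> B" for m by (rule hull_minimal[of _ _ convex, OF W(2) B(2)])
  have mono: "mono S"
    using V(1) W(1) unfolding S_def by (intro monoI minkowski_comb_mono hull_mono) (auto dest: monoD)
  have cS: "convex (S m)" for m unfolding S_def by (intro convex_minkowski_comb convex_convex_hull)
  have SK: "S m \<subseteq> minkowski_comb a A b B" for m unfolding S_def by (intro minkowski_comb_mono hV hW)
  have comp: "compact (minkowski_comb a A b B)" using A B by (intro compact_minkowski_comb)
  have "minkowski_comb a A b B \<subseteq> closure (\<Union>m. S m)"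
  proof
    fix z assume "z \<in> minkowski_comb a A b B"
    then obtain x y where xy: "x \<in> A" "y \<in> B" "z = a *\<^sub>R x + b *\<^sub>R y" by (auto simp: mem_minkowski_comb)
    obtain f where f: "\<forall>i. f i \<in> (\<Union>m. V m)" "f \<longlonglongrightarrow> x" using closure_sequential[of x "\<Union>m. V m"] subsetD[OF V(3)] xy by blast
    obtain g where g: "\<forall>i. g i \<in> (\<Union>m. W m)" "g \<longlonglongrightarrow> y" using closure_sequential[of y "\<Union>m. W m"] subsetD[OF W(3)] xy by blast
    have "(\<lambda>i. a *\<^sub>R f i + b *\<^sub>R g i) \<longlonglongrightarrow> z" unfolding xy by (intro tendsto_intros f g)
    moreover have "a *\<^sub>R f i + b *\<^sub>R g i \<in> (\<Union>m. S m)" for i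
    proof -
      obtain k l where "f i \<in> V k" "g i \<in> W l" using f g by blast
      then have "f i \<in> V (max k l)" "g i \<in> W (max k l)"
        using monoD[OF V(1), of k "max k l"] monoD[OF W(1), of l "max k l"] by auto
      then have "a *\<^sub>R f i + b *\<^sub>R g i \<in> S (max k l)"
        unfolding S_def mem_minkowski_comb
        by (intro bexI[of _ "f i"] bexI[of _ "g i"] refl hull_inc)
      then show ?thesis by blast
    qed
    ultimately show "z \<in> closure (\<Union>m. S m)"
      by (intro closure_sequential[THEN iffD2] exI[of _ "\<lambda>i. a *\<^sub>R f i + b *\<^sub>R g i"] conjI allI)
  qed
  then have eq: "measure lebesgue (\<Union>m. S m) = measure lebesgue (minkowski_comb a A b B)"
    using SK by (intro measure_eq_of_convex_dense convex_Union_mono cS mono comp) auto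
  have Sm: "S m \<in> lmeasurable" for m
    by (rule measurable_convex[OF cS bounded_subset[OF compact_imp_bounded[OF comp] SK]])
  have Um: "(\<Union>m. S m) \<in> lmeasurable"
    using SK bounded_subset[OF compact_imp_bounded[OF comp], of "\<Union>m. S m"]
    by (intro measurable_convex convex_Union_mono cS mono) auto
  have "(\<lambda>m. measure lebesgue (S m)) \<longlonglongrightarrow> measure lebesgue (\<Union>m. S m)"
    using Sm Um mono by (intro Lim_measure_incseq) (auto simp: fmeasurable_def)
  then show ?thesis unfolding eq unfolding S_def .
qed

lemma minkowski_comb_translation:
  "minkowski_comb a ((+) x ` A) b ((+) y ` B) = (+) (a *\<^sub>R x + b *\<^sub>R y) ` minkowski_comb a A b B"
proof -
  have "minkowski_comb a ((+) x ` A) b ((+) y ` B)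
      = (\<lambda>(x', y'). a *\<^sub>R (x + x') + b *\<^sub>R (y + y')) ` (A \<times> B)"
    unfolding minkowski_comb_def by force
  also have "\<dots> = (\<lambda>(x', y'). (a *\<^sub>R x + b *\<^sub>R y) + (a *\<^sub>R x' + b *\<^sub>R y')) ` (A \<times> B)"
    by (intro image_cong refl) (auto simp: algebra_simps)
  finally show ?thesis unfolding minkowski_comb_def by (simp add: image_image case_prod_beta)
qed

lemma minkowski_comb_mono_coeffs:
  fixes A B :: "'a::real_normed_vector set"
  assumes "convex A" "0 \<in> A" "convex B" "0 \<in> B" "0 \<le> a" "a \<le> a'" "0 \<le> b" "b \<le> b'"
  shows "minkowski_comb a A b B \<subseteq> minkowski_comb a' A b' B"
proof -
  have shrink: "\<exists>x'\<in>S. s *\<^sub>R x = t *\<^sub>R x'"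
    if "convex S" "0 \<in> S" "0 \<le> s" "s \<le> t" "x \<in> S" for S and x :: 'a and s t :: real
  proof (cases "t = 0")
    case False
    have "(s / t) *\<^sub>R x + (1 - s / t) *\<^sub>R 0 \<in> S"
      using that False by (intro convexD) (auto simp: field_simps)
    moreover have "s *\<^sub>R x = t *\<^sub>R ((s / t) *\<^sub>R x + (1 - s / t) *\<^sub>R 0)" using False by simp
    ultimately show ?thesis by blast
  qed (use that in auto)
  show ?thesis
  proof
    fix z assume "z \<in> minkowski_comb a A b B"
    then obtain x y where xy: "x \<in> A" "y \<in> B" "z = a *\<^sub>R x + b *\<^sub>R y" by (auto simp: mem_minkowski_comb)
    obtain x' where "x' \<in> A" "a *\<^sub>R x = a' *\<^sub>R x'" using shrink[of A a a' x] assms xy by blast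
    moreover obtain y' where "y' \<in> B" "b *\<^sub>R y = b' *\<^sub>R y'" using shrink[of B b b' y] assms xy by blast
    ultimately show "z \<in> minkowski_comb a' A b' B" unfolding xy mem_minkowski_comb by metis
  qed
qed

text \<open>Carries the polynomial formula to vanishing coefficients, which the slices of the cone
  do not reach. After translations that put 0 into both bodies, the combinations shrink with their
  coefficients, and compactness identifies the intersection.\<close>

lemma measure_minkowski_comb_right_limit:
  fixes A B :: "'a::euclidean_space set"
  assumes A: "compact A" "convex A" "A \<noteq> {}" and B: "compact B" "convex B" "B \<noteq> {}"
    and ab: "a \<ge> 0" "b \<ge> 0"
  shows "(\<lambda>m. measure lebesgue (minkowski_comb (a + 1 / Suc m) A (b + 1 / Suc m) B))
    \<longlonglongrightarrow> measure lebesgue (minkowski_comb a A b B)"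
proof -
  obtain x0 y0 where x0: "x0 \<in> A" and y0: "y0 \<in> B" using A B by blast
  define A' where "A' = (+) (- x0) ` A"
  define B' where "B' = (+) (- y0) ` B"
  have A': "compact A'" "convex A'" "0 \<in> A'" and B': "compact B'" "convex B'" "0 \<in> B'"
    using compact_translation[OF A(1), of "- x0"] convex_translation[OF A(2), of "- x0"] imageI[OF x0, of "(+) (- x0)"]
      compact_translation[OF B(1), of "- y0"] convex_translation[OF B(2), of "- y0"] imageI[OF y0, of "(+) (- y0)"]
    unfolding A'_def B'_def by simp_all
  have tr: "measure lebesgue (minkowski_comb s A t B) = measure lebesgue (minkowski_comb s A' t B')" for s t
    unfolding A'_def B'_def minkowski_comb_translation measure_translation ..
  define S where "S m = minkowski_comb (a + 1 / Suc m) A' (b + 1 / Suc m) B'" for m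
  have comp: "compact (minkowski_comb s A' t B')" for s t using A' B' by (intro compact_minkowski_comb)
  have dec: "decseq S"
    unfolding S_def using A' B' ab
    by (intro decseq_SucI minkowski_comb_mono_coeffs) (auto simp: field_simps)
  obtain R where R: "\<And>x. x \<in> A' \<Longrightarrow> norm x \<le> R" "\<And>x. x \<in> B' \<Longrightarrow> norm x \<le> R"
    using compact_imp_bounded[OF compact_Un[OF A'(1) B'(1)]] unfolding bounded_iff by blast
  have "(\<Inter>m. S m) = minkowski_comb a A' b B'"
  proof
    show "minkowski_comb a A' b B' \<subseteq> (\<Inter>m. S m)"
      unfolding S_def using A' B' ab by (intro INT_greatest minkowski_comb_mono_coeffs) auto
    show "(\<Inter>m. S m) \<subseteq> minkowski_comb a A' b B'"
    proof
      fix z assume "z \<in> (\<Inter>m. S m)"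
      then have "\<forall>m. \<exists>p. fst p \<in> A' \<and> snd p \<in> B' \<and> z = (a + 1 / Suc m) *\<^sub>R fst p + (b + 1 / Suc m) *\<^sub>R snd p"
        by (auto simp: S_def mem_minkowski_comb) blast
      from choice[OF this] obtain p where p: "\<And>m. fst (p m) \<in> A'" "\<And>m. snd (p m) \<in> B'"
        "\<And>m. z = (a + 1 / Suc m) *\<^sub>R fst (p m) + (b + 1 / Suc m) *\<^sub>R snd (p m)" by blast
      let ?y = "\<lambda>m. a *\<^sub>R fst (p m) + b *\<^sub>R snd (p m)"
      \<comment> \<open>Lowering the two coefficients to a and b displaces the point by at most 2R /
        (m + 1), so \<open>z\<close> is a limit of points of a closed set.\<close>
      have "norm (?y m - z) \<le> inverse (Suc m) * (R + R)" for m
      proof -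
        have "?y m - z = - (inverse (Suc m) *\<^sub>R (fst (p m) + snd (p m)))"
          by (subst p(3)[of m]) (simp add: algebra_simps divide_inverse)
        also have "norm \<dots> = inverse (Suc m) * norm (fst (p m) + snd (p m))" by simp
        also have "\<dots> \<le> inverse (Suc m) * (R + R)"
          using R(1)[OF p(1)[of m]] R(2)[OF p(2)[of m]] norm_triangle_ineq[of "fst (p m)" "snd (p m)"]
          by (intro mult_left_mono) auto
        finally show ?thesis .
      qed
      moreover have "(\<lambda>m. inverse (real (Suc m)) * (R + R)) \<longlonglongrightarrow> 0"
        by (rule tendsto_mult_left_zero[OF LIMSEQ_inverse_real_of_nat])
      ultimately have "(\<lambda>m. ?y m - z) \<longlonglongrightarrow> 0"
        by (intro Lim_null_comparison[of "\<lambda>m. ?y m - z" "\<lambda>m. inverse (real (Suc m)) * (R + R)"] always_eventually allI)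
      then have "?y \<longlonglongrightarrow> z" by (simp add: LIM_zero_iff)
      have "?y m \<in> minkowski_comb a A' b B'" for m
        unfolding mem_minkowski_comb using p by blast
      with \<open>?y \<longlonglongrightarrow> z\<close> show "z \<in> minkowski_comb a A' b B'"
        by (rule closed_sequentially[OF compact_imp_closed[OF comp], rotated])
    qed
  qed
  moreover have "(\<lambda>m. measure lebesgue (S m)) \<longlonglongrightarrow> measure lebesgue (\<Inter>m. S m)"
  proof (rule Lim_measure_decseq[OF _ dec])
    have Sm: "S m \<in> lmeasurable" for m unfolding S_def by (rule lmeasurable_compact[OF comp])
    show "range S \<subseteq> sets lebesgue" using Sm by auto
    show "emeasure lebesgue (S m) \<noteq> \<infinity>" for m unfolding infinity_ennreal_def by (rule fmeasurableD2[OF Sm])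
  qed
  ultimately show ?thesis by (simp add: tr S_def)
qed

lemma bounded_coefficients_subseq:
  fixes C :: "nat \<Rightarrow> nat \<Rightarrow> real"
  assumes "\<And>m k. k < n \<Longrightarrow> C m k \<in> {0..R}"
  shows "\<exists>r. strict_mono r \<and> (\<forall>k<n. \<exists>l\<in>{0..R}. (\<lambda>m. C (r m) k) \<longlonglongrightarrow> l)"
  using assms
proof (induction n)
  case 0
  show ?case by (intro exI[of _ "\<lambda>x. x"]) (auto simp: strict_mono_def)
next
  case (Suc n)
  then obtain r where r: "strict_mono r" "\<forall>k<n. \<exists>l\<in>{0..R}. (\<lambda>m. C (r m) k) \<longlonglongrightarrow> l" by force
  have "\<forall>m. C (r m) n \<in> {0..R}" using Suc.prems by blast
  then obtain l s where s: "l \<in> {0..R}" "strict_mono (s :: nat \<Rightarrow> nat)" "((\<lambda>m. C (r m) n) \<circ> s) \<longlonglongrightarrow> l"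
    using compact_Icc[of 0 R, unfolded compact_def] by metis
  have "\<exists>l\<in>{0..R}. (\<lambda>m. C ((r \<circ> s) m) k) \<longlonglongrightarrow> l" if "k < Suc n" for k
  proof (cases "k = n")
    case True
    then show ?thesis using s by (auto simp: o_def)
  next
    case False
    then have "k < n" using that by simp
    then obtain l where "l \<in> {0..R}" "(\<lambda>m. C (r m) k) \<longlonglongrightarrow> l" using r(2) by blast
    then show ?thesis using LIMSEQ_subseq_LIMSEQ[of "\<lambda>m. C (r m) k" l s] s by (auto simp: o_def)
  qed
  then show ?case using strict_mono_o[OF r(1) s(2)] by blast
qed

text \<open>Approximating polytopes provide polynomials with nonnegative coefficients. Nonnegativity
  bounds each coefficient by the value at (1, 1), and monotonicity bounds that by the value for the
  bodies themselves. Hence a subsequence of the coefficient vectors converges, and the limiting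
  polynomial gives the volumes.\<close>

lemma minkowski_polynomial:
  fixes A B :: "'a::euclidean_space set"
  assumes A: "compact A" "convex A" "A \<noteq> {}" and B: "compact B" "convex B" "B \<noteq> {}"
  obtains C where "\<And>k. C k \<ge> (0::real)"
    "\<And>a b. a \<ge> 0 \<Longrightarrow> b \<ge> 0 \<Longrightarrow>
       measure lebesgue (minkowski_comb a A b B) = (\<Sum>k\<le>DIM('a). C k * a ^ k * b ^ (DIM('a) - k))"
proof -
  let ?N = "DIM('a)"
  let ?g = "\<lambda>a b. measure lebesgue (minkowski_comb a A b B)"
  obtain V :: "nat \<Rightarrow> 'a set" where V: "\<forall>m. finite (V m)" "mono V" "\<forall>m. V m \<subseteq> A" "A \<subseteq> closure (\<Union>m. V m)"
    by (rule finite_exhaustion[OF A(3)])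
  note V = V(1)[rule_format] V(2) V(3)[rule_format] V(4)
  obtain W :: "nat \<Rightarrow> 'a set" where W: "\<forall>m. finite (W m)" "mono W" "\<forall>m. W m \<subseteq> B" "B \<subseteq> closure (\<Union>m. W m)"
    by (rule finite_exhaustion[OF B(3)])
  note W = W(1)[rule_format] W(2) W(3)[rule_format] W(4)
  let ?h = "\<lambda>m a b. measure lebesgue (minkowski_comb a (convex hull V m) b (convex hull W m))"
  have "\<exists>C. (\<forall>k. C k \<ge> (0::real)) \<and> (\<forall>a b. a > 0 \<longrightarrow> b > 0 \<longrightarrow> ?h m a b = (\<Sum>k\<le>?N. C k * a ^ k * b ^ (?N - k)))" for m
    by (rule minkowski_polynomial_polytope[OF V(1)[of m] W(1)[of m]]) blast
  then have "\<forall>m. \<exists>C. (\<forall>k. C k \<ge> (0::real)) \<and> (\<forall>a b. a > 0 \<longrightarrow> b > 0 \<longrightarrow> ?h m a b = (\<Sum>k\<le>?N. C k * a ^ k * b ^ (?N - k)))"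
    by blast
  from choice[OF this] obtain C where C0: "\<And>m k. C m k \<ge> (0::real)"
    and C: "\<And>m a b. a > 0 \<Longrightarrow> b > 0 \<Longrightarrow> ?h m a b = (\<Sum>k\<le>?N. C m k * a ^ k * b ^ (?N - k))" by blast
  have "C m k \<in> {0..?g 1 1}" if "k < Suc ?N" for m k
  proof -
    have "C m k \<le> (\<Sum>k\<le>?N. C m k)" using that C0 by (intro member_le_sum) auto
    also have "\<dots> = ?h m 1 1" using C[of 1 1 m] by simp
    also have "\<dots> \<le> ?g 1 1"
    proof (rule measure_mono_fmeasurable)
      show "minkowski_comb 1 (convex hull V m) 1 (convex hull W m) \<subseteq> minkowski_comb 1 A 1 B"
        using V(3) W(3) A B by (intro minkowski_comb_mono hull_minimal)
      have "compact (minkowski_comb 1 (convex hull V m) 1 (convex hull W m))"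
        by (intro compact_minkowski_comb finite_imp_compact_convex_hull V W)
      then show "minkowski_comb 1 (convex hull V m) 1 (convex hull W m) \<in> sets lebesgue"
        using lmeasurable_compact by blast
      show "minkowski_comb 1 A 1 B \<in> lmeasurable"
        using A B by (intro lmeasurable_compact compact_minkowski_comb)
    qed
    finally show ?thesis using C0 by simp
  qed
  then have "\<exists>r. strict_mono r \<and> (\<forall>k<Suc ?N. \<exists>l\<in>{0..?g 1 1}. (\<lambda>m. C (r m) k) \<longlonglongrightarrow> l)"
    by (rule bounded_coefficients_subseq)
  then obtain r where r: "strict_mono r" "\<forall>k<Suc ?N. \<exists>l\<in>{0..?g 1 1}. (\<lambda>m. C (r m) k) \<longlonglongrightarrow> l" by blast
  then have "\<forall>k. \<exists>l. k < Suc ?N \<longrightarrow> l \<ge> 0 \<and> (\<lambda>m. C (r m) k) \<longlonglongrightarrow> l" by (metis atLeastAtMost_iff)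
  from choice[OF this] obtain c where c: "\<And>k. k < Suc ?N \<Longrightarrow> c k \<ge> 0" "\<And>k. k < Suc ?N \<Longrightarrow> (\<lambda>m. C (r m) k) \<longlonglongrightarrow> c k"
    by blast
  have pos: "?g a b = (\<Sum>k\<le>?N. c k * a ^ k * b ^ (?N - k))" if ab: "a > 0" "b > 0" for a b
  proof (rule LIMSEQ_unique)
    have "(\<lambda>m. ?h m a b) \<longlonglongrightarrow> ?g a b"
      by (rule measure_minkowski_comb_exhaustion[OF A(1,2) B(1,2) V(2-4) W(2-4)])
    from LIMSEQ_subseq_LIMSEQ[OF this r(1)] show "(\<lambda>m. ?h (r m) a b) \<longlonglongrightarrow> ?g a b" by (simp add: o_def)
    show "(\<lambda>m. ?h (r m) a b) \<longlonglongrightarrow> (\<Sum>k\<le>?N. c k * a ^ k * b ^ (?N - k))"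
      unfolding C[OF ab] by (intro tendsto_intros c) auto
  qed
  \<comment> \<open>The boundary of the quadrant has to be included, since the mixed volume
    differentiates at the origin.\<close>
  have "?g a b = (\<Sum>k\<le>?N. c k * a ^ k * b ^ (?N - k))" if ab: "a \<ge> 0" "b \<ge> 0" for a b
  proof (rule LIMSEQ_unique)
    show "(\<lambda>m. ?g (a + 1 / Suc m) (b + 1 / Suc m)) \<longlonglongrightarrow> ?g a b"
      by (rule measure_minkowski_comb_right_limit[OF A B ab])
    have lim: "(\<lambda>m. s + 1 / real (Suc m)) \<longlonglongrightarrow> s" for s :: real
      using LIMSEQ_inverse_real_of_nat_add[of s] by (simp add: divide_inverse)
    have gt: "a + 1 / real (Suc m) > 0" "b + 1 / real (Suc m) > 0" for m
      using ab by (simp_all add: add_nonneg_pos)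
    show "(\<lambda>m. ?g (a + 1 / Suc m) (b + 1 / Suc m)) \<longlonglongrightarrow> (\<Sum>k\<le>?N. c k * a ^ k * b ^ (?N - k))"
      unfolding pos[OF gt] by (intro tendsto_intros lim)
  qed
  \<comment> \<open>Coefficients beyond the degree are set to 0, so that nonnegativity holds at
    every index.\<close>
  then show ?thesis
    using c(1) by (intro that[of "\<lambda>k. if k \<le> ?N then c k else 0"]) auto
qed

section \<open>Mixed volumes of two bodies\<close>

text \<open>The weights s / (s + t) and t / (s + t) form a convex combination. The resulting
  inclusion of sA + tA in (s + t)A merges repeated bodies in a Minkowski sum and later keeps a
  translate of \<rho> K inside a fibre.\<close>

lemma scaled_convex_add:
  fixes A :: "'a::real_vector set"
  assumes "convex A" "x \<in> A" "y \<in> A" "s \<ge> 0" "t \<ge> 0"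
  shows "s *\<^sub>R x + t *\<^sub>R y \<in> (\<lambda>z. (s + t) *\<^sub>R z) ` A"
proof (cases "s + t = 0")
  case True
  then have "s = 0" "t = 0" using assms by linarith+
  then show ?thesis using assms by auto
next
  case False
  have "(s / (s + t)) *\<^sub>R x + (t / (s + t)) *\<^sub>R y \<in> A"
    using assms False by (intro convexD) (auto simp: add_divide_distrib[symmetric])
  moreover have "s *\<^sub>R x + t *\<^sub>R y = (s + t) *\<^sub>R ((s / (s + t)) *\<^sub>R x + (t / (s + t)) *\<^sub>R y)"
    using False by (simp add: scaleR_add_right)
  ultimately show ?thesis by blast
qed

lemma sum_scaled_convex:
  fixes A :: "'a::real_vector set"
  assumes A: "convex A" "A \<noteq> {}" and "finite I" "\<And>i. i \<in> I \<Longrightarrow> t i \<ge> 0"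
  shows "(\<Sum>i\<in>I. (\<lambda>x. t i *\<^sub>R x) ` A) = (\<lambda>x. (\<Sum>i\<in>I. t i) *\<^sub>R x) ` A"
  using assms(3,4)
proof (induction I)
  case empty
  show ?case using A(2) by auto
next
  case (insert i I)
  define s where "s = (\<Sum>i\<in>I. t i)"
  have s: "s \<ge> 0" "t i \<ge> 0" using insert.prems by (auto simp: s_def intro!: sum_nonneg)
  have "(\<lambda>x. t i *\<^sub>R x) ` A + (\<lambda>x. s *\<^sub>R x) ` A = (\<lambda>x. (t i + s) *\<^sub>R x) ` A"
  proof (intro equalityI subsetI)
    fix z assume "z \<in> (\<lambda>x. t i *\<^sub>R x) ` A + (\<lambda>x. s *\<^sub>R x) ` A"
    then obtain x y where xy: "x \<in> A" "y \<in> A" "z = t i *\<^sub>R x + s *\<^sub>R y" by (auto simp: set_plus_def)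
    then show "z \<in> (\<lambda>x. (t i + s) *\<^sub>R x) ` A" using scaled_convex_add[OF A(1) xy(1,2) s(2,1)] by simp
  next
    fix z assume "z \<in> (\<lambda>x. (t i + s) *\<^sub>R x) ` A"
    then obtain x where "x \<in> A" "z = t i *\<^sub>R x + s *\<^sub>R x" by (auto simp: scaleR_add_left)
    then show "z \<in> (\<lambda>x. t i *\<^sub>R x) ` A + (\<lambda>x. s *\<^sub>R x) ` A"
      by (auto intro!: set_plus_intro)
  qed
  then show ?case using insert by (simp add: s_def)
qed

lemma minkowski_volume_two_bodies:
  fixes A B :: "'a::euclidean_space set"
  assumes A: "convex A" "A \<noteq> {}" and B: "convex B" "B \<noteq> {}" and t: "\<And>i. t i \<ge> 0" and "j \<le> N"
  shows "minkowski_volume (replicate j A @ replicate (N - j) B) t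
    = measure lebesgue (minkowski_comb (\<Sum>i<j. t i) A (\<Sum>i\<in>{j..<N}. t i) B)"
proof -
  let ?Ks = "replicate j A @ replicate (N - j) B"
  have "(\<Sum>i<length ?Ks. (\<lambda>x. t i *\<^sub>R x) ` (?Ks ! i))
      = (\<Sum>i\<in>{..<j} \<union> {j..<N}. (\<lambda>x. t i *\<^sub>R x) ` (?Ks ! i))"
    using \<open>j \<le> N\<close> by (intro sum.cong) auto
  also have "\<dots> = (\<Sum>i<j. (\<lambda>x. t i *\<^sub>R x) ` (?Ks ! i)) + (\<Sum>i\<in>{j..<N}. (\<lambda>x. t i *\<^sub>R x) ` (?Ks ! i))"
    by (intro sum.union_disjoint) auto
  also have "(\<Sum>i<j. (\<lambda>x. t i *\<^sub>R x) ` (?Ks ! i)) = (\<Sum>i<j. (\<lambda>x. t i *\<^sub>R x) ` A)"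
    by (intro sum.cong) (auto simp: nth_append)
  also have "(\<Sum>i\<in>{j..<N}. (\<lambda>x. t i *\<^sub>R x) ` (?Ks ! i)) = (\<Sum>i\<in>{j..<N}. (\<lambda>x. t i *\<^sub>R x) ` B)"
    by (intro sum.cong) (auto simp: nth_append)
  also have "(\<Sum>i<j. (\<lambda>x. t i *\<^sub>R x) ` A) = (\<lambda>x. (\<Sum>i<j. t i) *\<^sub>R x) ` A"
    by (intro sum_scaled_convex A t) auto
  also have "(\<Sum>i\<in>{j..<N}. (\<lambda>x. t i *\<^sub>R x) ` B) = (\<lambda>x. (\<Sum>i\<in>{j..<N}. t i) *\<^sub>R x) ` B"
    by (intro sum_scaled_convex B t) auto
  also have "(\<lambda>x. (\<Sum>i<j. t i) *\<^sub>R x) ` A + (\<lambda>x. (\<Sum>i\<in>{j..<N}. t i) *\<^sub>R x) ` B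
      = minkowski_comb (\<Sum>i<j. t i) A (\<Sum>i\<in>{j..<N}. t i) B"
    unfolding set_plus_def minkowski_comb_def by force
  finally show ?thesis unfolding minkowski_volume_def by simp
qed

section \<open>Iterated one-sided derivatives of a polynomial in two partial sums\<close>

lemma partial_orthant_eqI:
  assumes "\<And>s. s \<ge> 0 \<Longrightarrow> F (t(i := s)) = G s"
    and "(G has_real_derivative D) (at (t i))" and "t i \<ge> 0"
  shows "partial_orthant i F t = D"
proof -
  have "at (t i) within {0..} \<noteq> bot"
  proof -
    \<comment> \<open>The half-line accumulates at \<open>t i\<close> even when
      \<open>t i = 0\<close>. So the one-sided derivative is unique, and it equals the two-sided
      derivative of the extension \<open>G\<close>.\<close>
    have "at (t i) within {t i<..} \<le> at (t i) within {0..}"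
      using assms(3) by (intro at_le) auto
    then show ?thesis using trivial_limit_at_right_real[of "t i"] by (metis bot.extremum_uniqueI)
  qed
  moreover have "(G has_vector_derivative D) (at (t i) within {0..})"
    by (rule has_vector_derivative_at_within)
       (use assms(2) in \<open>simp only: has_real_derivative_iff_has_vector_derivative\<close>)
  then have "((\<lambda>s. F (t(i := s))) has_vector_derivative D) (at (t i) within {0..})"
    by (rule has_vector_derivative_transform[rotated 2]) (use assms in auto)
  ultimately show ?thesis
    unfolding partial_orthant_def by (rule vector_derivative_within)
qed

text \<open>\<open>foldr\<close> differentiates in the last index first, hence the induction on the
  length \<open>d\<close> of a suffix. The formula is claimed at every point of the orthant, because
  the next derivative varies one more coordinate. Truncated exponents do no harm: once
  \<open>d\<close> exceeds \<open>N - k\<close>, the falling factorial contains a factor 0.\<close>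

lemma foldr_partial_orthant_second:
  fixes C :: "nat \<Rightarrow> real"
  assumes F: "\<And>t. (\<And>i. t i \<ge> 0) \<Longrightarrow> F t = (\<Sum>k\<le>N. C k * (\<Sum>i<j. t i) ^ k * (\<Sum>i\<in>{j..<N}. t i) ^ (N - k))"
  shows "d \<le> N - j \<Longrightarrow> (\<And>i. t i \<ge> 0) \<Longrightarrow>
    foldr partial_orthant [N - d..<N] F t
      = (\<Sum>k\<le>N. C k * (\<Prod>r<d. real (N - k - r)) * (\<Sum>i<j. t i) ^ k * (\<Sum>i\<in>{j..<N}. t i) ^ (N - k - d))"
proof (induction d arbitrary: t)
  case 0
  then show ?case using F by simp
next
  case (Suc d)
  define i where "i = N - Suc d"
  have i: "j \<le> i" "i < N" using Suc.prems(1) by (auto simp: i_def)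
  have upt: "[N - Suc d..<N] = i # [N - d..<N]"
  proof -
    have "Suc i = N - d" using Suc.prems(1) by (simp add: i_def)
    then show ?thesis using upt_conv_Cons[OF i(2)] by (simp add: i_def)
  qed
  have sum1: "(\<Sum>l<j. (t(i := s)) l) = (\<Sum>l<j. t l)" for s
    using i by (intro sum.cong) auto
  define b where "b = (\<Sum>l\<in>{j..<N} - {i}. t l)"
  have sum2: "(\<Sum>l\<in>{j..<N}. (t(i := s)) l) = s + b" for s
  proof -
    have "(\<Sum>l\<in>{j..<N}. (t(i := s)) l) = (t(i := s)) i + (\<Sum>l\<in>{j..<N} - {i}. (t(i := s)) l)"
      using i by (intro sum.remove) auto
    also have "(\<Sum>l\<in>{j..<N} - {i}. (t(i := s)) l) = b" unfolding b_def by (intro sum.cong) auto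
    finally show ?thesis by simp
  qed
  let ?a = "\<Sum>l<j. t l"
  let ?p = "\<lambda>k. \<Prod>r<d. real (N - k - r)"
  have "foldr partial_orthant [N - Suc d..<N] F t = partial_orthant i (foldr partial_orthant [N - d..<N] F) t"
    by (simp add: upt)
  also have "\<dots> = (\<Sum>k\<le>N. C k * ?p k * ?a ^ k * (real (N - k - d) * (t i + b) ^ (N - k - d - 1)))"
  proof (rule partial_orthant_eqI)
    show "foldr partial_orthant [N - d..<N] F (t(i := s)) = (\<Sum>k\<le>N. C k * ?p k * ?a ^ k * (s + b) ^ (N - k - d))"
      if "s \<ge> 0" for s
    proof -
      have "(t(i := s)) l \<ge> 0" for l using Suc.prems(2) that by simp
      moreover have "d \<le> N - j" using Suc.prems(1) by simp
      ultimately show ?thesis using Suc.IH[of "t(i := s)"] unfolding sum1 sum2 by blast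
    qed
    show "((\<lambda>s. \<Sum>k\<le>N. C k * ?p k * ?a ^ k * (s + b) ^ (N - k - d)) has_real_derivative
        (\<Sum>k\<le>N. C k * ?p k * ?a ^ k * (real (N - k - d) * (t i + b) ^ (N - k - d - 1)))) (at (t i))"
      by (auto intro!: derivative_eq_intros sum.cong)
  qed (rule Suc.prems)
  also have "t i + b = (\<Sum>l\<in>{j..<N}. t l)" using sum2[of "t i"] by simp
  finally show ?case by (simp add: mult_ac)
qed

text \<open>The remaining derivatives act on the first partial sum only. The power of the second one
  is carried along as a constant, so its exponent may be any function \<open>e\<close> of
  \<open>k\<close>.\<close>

lemma foldr_partial_orthant_first:
  fixes C :: "nat \<Rightarrow> real"
  assumes "j \<le> N" and F: "\<And>t. (\<And>i. t i \<ge> 0) \<Longrightarrow> F t = (\<Sum>k\<le>N. C k * (\<Sum>i<j. t i) ^ k * (\<Sum>i\<in>{j..<N}. t i) ^ e k)"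
  shows "d \<le> j \<Longrightarrow> (\<And>i. t i \<ge> 0) \<Longrightarrow>
    foldr partial_orthant [j - d..<j] F t
      = (\<Sum>k\<le>N. C k * (\<Prod>r<d. real (k - r)) * (\<Sum>i<j. t i) ^ (k - d) * (\<Sum>i\<in>{j..<N}. t i) ^ e k)"
proof (induction d arbitrary: t)
  case 0
  then show ?case using F by simp
next
  case (Suc d)
  define i where "i = j - Suc d"
  have i: "i < j" using Suc.prems(1) by (auto simp: i_def)
  have upt: "[j - Suc d..<j] = i # [j - d..<j]"
  proof -
    have "Suc i = j - d" using Suc.prems(1) by (simp add: i_def)
    then show ?thesis using upt_conv_Cons[OF i] by (simp add: i_def)
  qed
  have sum2: "(\<Sum>l\<in>{j..<N}. (t(i := s)) l) = (\<Sum>l\<in>{j..<N}. t l)" for s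
    using i by (intro sum.cong) auto
  define a where "a = (\<Sum>l\<in>{..<j} - {i}. t l)"
  have sum1: "(\<Sum>l<j. (t(i := s)) l) = s + a" for s
  proof -
    have "(\<Sum>l<j. (t(i := s)) l) = (t(i := s)) i + (\<Sum>l\<in>{..<j} - {i}. (t(i := s)) l)"
      using i by (intro sum.remove) auto
    also have "(\<Sum>l\<in>{..<j} - {i}. (t(i := s)) l) = a" unfolding a_def by (intro sum.cong) auto
    finally show ?thesis by simp
  qed
  let ?b = "\<lambda>k. (\<Sum>l\<in>{j..<N}. t l) ^ e k"
  let ?p = "\<lambda>k. \<Prod>r<d. real (k - r)"
  have "foldr partial_orthant [j - Suc d..<j] F t = partial_orthant i (foldr partial_orthant [j - d..<j] F) t"
    by (simp add: upt)
  also have "\<dots> = (\<Sum>k\<le>N. C k * ?p k * (real (k - d) * (t i + a) ^ (k - d - 1)) * ?b k)"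
  proof (rule partial_orthant_eqI)
    show "foldr partial_orthant [j - d..<j] F (t(i := s)) = (\<Sum>k\<le>N. C k * ?p k * (s + a) ^ (k - d) * ?b k)"
      if "s \<ge> 0" for s
    proof -
      have "(t(i := s)) l \<ge> 0" for l using Suc.prems(2) that by simp
      moreover have "d \<le> j" using Suc.prems(1) by simp
      ultimately show ?thesis using Suc.IH[of "t(i := s)"] unfolding sum1 sum2 by blast
    qed
    show "((\<lambda>s. \<Sum>k\<le>N. C k * ?p k * (s + a) ^ (k - d) * ?b k) has_real_derivative
        (\<Sum>k\<le>N. C k * ?p k * (real (k - d) * (t i + a) ^ (k - d - 1)) * ?b k)) (at (t i))"
      by (auto intro!: derivative_eq_intros sum.cong)
  qed (rule Suc.prems)
  also have "t i + a = (\<Sum>l<j. t l)" using sum1[of "t i"] by simp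
  finally show ?case by (simp add: mult_ac)
qed

text \<open>Differentiating N - j times in the second group and j times in the first, and evaluating
  at 0, isolates one coefficient: lower indices are killed by the falling factorial, higher ones by
  a positive power of 0, and at k = j both powers are 0^0 = 1.\<close>

lemma mixed_volume_two_bodies:
  fixes A B :: "'a::euclidean_space set"
  assumes A: "convex A" "A \<noteq> {}" and B: "convex B" "B \<noteq> {}" and j: "j \<le> N"
    and C: "\<And>a b. a \<ge> 0 \<Longrightarrow> b \<ge> 0 \<Longrightarrow>
       measure lebesgue (minkowski_comb a A b B) = (\<Sum>k\<le>N. C k * a ^ k * b ^ (N - k))"
  shows "mixed_volume (replicate j A @ replicate (N - j) B) = C j * fact j * fact (N - j) / fact N"
proof -
  define F where "F = minkowski_volume (replicate j A @ replicate (N - j) B)"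
  define G where "G = foldr partial_orthant [j..<N] F"
  let ?p = "\<lambda>k. \<Prod>r<N - j. real (N - k - r)"
  have F: "F t = (\<Sum>k\<le>N. C k * (\<Sum>i<j. t i) ^ k * (\<Sum>i\<in>{j..<N}. t i) ^ (N - k))" if "\<And>i. t i \<ge> 0" for t
    unfolding F_def minkowski_volume_two_bodies[OF A B that j]
    by (intro C sum_nonneg that)
  have G: "G t = (\<Sum>k\<le>N. (C k * ?p k) * (\<Sum>i<j. t i) ^ k * (\<Sum>i\<in>{j..<N}. t i) ^ (N - k - (N - j)))"
    if "\<And>i. t i \<ge> 0" for t
    using foldr_partial_orthant_second[where F = F and d = "N - j", OF F _ that] j by (simp add: G_def)
  have "foldr partial_orthant [0..<N] F (\<lambda>_. 0) = foldr partial_orthant [0..<j] G (\<lambda>_. 0)"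
  proof -
    have "[0..<N] = [0..<j] @ [j..<N]" using upt_add_eq_append[of 0 j "N - j"] j by simp
    then show ?thesis by (simp add: G_def)
  qed
  also have "\<dots> = (\<Sum>k\<le>N. (C k * ?p k) * (\<Prod>r<j. real (k - r)) * (\<Sum>i<j. 0) ^ (k - j)
      * (\<Sum>i\<in>{j..<N}. 0) ^ (N - k - (N - j)))"
    using foldr_partial_orthant_first[where F = G and d = j, OF j G, of "\<lambda>_. 0"] by simp
  also have "\<dots> = (\<Sum>k\<in>{j}. (C k * ?p k) * (\<Prod>r<j. real (k - r)) * (\<Sum>i<j. 0) ^ (k - j)
      * (\<Sum>i\<in>{j..<N}. 0) ^ (N - k - (N - j)))"
  proof (rule sum.mono_neutral_right)
    show "\<forall>k\<in>{..N} - {j}. (C k * ?p k) * (\<Prod>r<j. real (k - r)) * (\<Sum>i<j. 0) ^ (k - j)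
      * (\<Sum>i\<in>{j..<N}. 0) ^ (N - k - (N - j)) = 0"
    proof
      fix k assume "k \<in> {..N} - {j}"
      then consider "k < j" | "j < k" by force
      then show "(C k * ?p k) * (\<Prod>r<j. real (k - r)) * (\<Sum>i<j. 0) ^ (k - j)
          * (\<Sum>i\<in>{j..<N}. 0) ^ (N - k - (N - j)) = 0"
      proof cases
        case 1
        then have "(\<Prod>r<j. real (k - r)) = 0" by (intro prod_zero) auto
        then show ?thesis by simp
      qed auto
    qed
  qed (use j in auto)
  also have "\<dots> = C j * (\<Prod>r<N - j. real (N - j - r)) * (\<Prod>r<j. real (j - r))" by simp
  also have "(\<Prod>r<N - j. real (N - j - r)) = fact (N - j)"
    by (simp add: fact_prod_rev lessThan_atLeast0)
  also have "(\<Prod>r<j. real (j - r)) = fact j"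
    by (simp add: fact_prod_rev lessThan_atLeast0)
  finally have "foldr partial_orthant [0..<N] F (\<lambda>_. 0) = C j * fact (N - j) * fact j" .
  then show ?thesis using j by (simp add: mixed_volume_def F_def mult_ac)
qed

section \<open>The fibre inequality\<close>

lemma prod_Basis_vec:
  "(\<Prod>b\<in>(Basis :: ('a::euclidean_space ^ 'p) set). f b) = (\<Prod>i\<in>UNIV. \<Prod>b\<in>Basis. f (axis i b))"
proof -
  have "(\<Prod>i\<in>UNIV. \<Prod>b\<in>(Basis::'a set). f (axis i b)) = (\<Prod>(i, b)\<in>(UNIV::'p set) \<times> Basis. f (axis i b))"
    by (rule prod.cartesian_product)
  also have "\<dots> = (\<Prod>b\<in>(\<lambda>(i, b). axis i b) ` ((UNIV::'p set) \<times> (Basis::'a set)). f b)"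
  proof (subst prod.reindex)
    show "inj_on (\<lambda>(i, b). axis i b) ((UNIV::'p set) \<times> (Basis::'a set))"
      by (auto simp: inj_on_def axis_eq_axis nonzero_Basis)
  qed (simp add: comp_def case_prod_beta)
  also have "(\<lambda>(i, b). axis i b) ` ((UNIV::'p set) \<times> (Basis::'a set)) = Basis"
    by (auto simp: Basis_vec_def)
  finally show ?thesis by simp
qed

lemma borel_measurable_vec_lambda:
  "vec_lambda \<in> borel_measurable (Pi\<^sub>M UNIV (\<lambda>_::'p::finite. lborel :: 'a::euclidean_space measure))"
proof (subst borel_measurable_euclidean_space, rule ballI)
  fix b :: "'a ^ 'p" assume "b \<in> Basis"
  then obtain i c where b: "b = axis i c" by (auto simp: Basis_vec_def)
  have "(\<lambda>x. x i \<bullet> c) \<in> borel_measurable (Pi\<^sub>M UNIV (\<lambda>_::'p. lborel :: 'a measure))"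
    by measurable
  then show "(\<lambda>x. vec_lambda x \<bullet> b) \<in> borel_measurable (Pi\<^sub>M UNIV (\<lambda>_::'p. lborel :: 'a measure))"
    by (simp add: b inner_axis)
qed

text \<open>A box in the power is the product of its coordinate boxes, and volumes of boxes
  determine Lebesgue measure. The identification with a product measure later gives the volume of
  \<open>cartesian_power K\<close>.\<close>

lemma lborel_vec_eq_distr:
  "(lborel :: ('a::euclidean_space ^ 'p) measure)
    = distr (Pi\<^sub>M UNIV (\<lambda>_::'p. lborel :: 'a measure)) borel vec_lambda"
proof (rule lborel_eqI)
  interpret product_sigma_finite "\<lambda>_::'p. lborel :: 'a measure" ..
  note [measurable] = borel_measurable_vec_lambda
  fix l u :: "'a ^ 'p" assume lu: "\<And>b. b \<in> Basis \<Longrightarrow> l \<bullet> b \<le> u \<bullet> b"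
  have lu': "l $ i \<bullet> b \<le> u $ i \<bullet> b" if "b \<in> Basis" for i b
    using lu[of "axis i b"] that by (simp add: inner_axis)
  have "vec_lambda -` box l u \<inter> space (Pi\<^sub>M UNIV (\<lambda>_::'p. lborel)) = (\<Pi>\<^sub>E i\<in>UNIV. box (l $ i) (u $ i))"
    by (auto simp: box_def Basis_vec_def inner_axis space_PiM PiE_iff)
  then have "emeasure (distr (Pi\<^sub>M UNIV (\<lambda>_::'p. lborel :: 'a measure)) borel vec_lambda) (box l u)
      = (\<Prod>i\<in>UNIV. emeasure lborel (box (l $ i) (u $ i)))"
    by (subst emeasure_distr) (auto simp: emeasure_PiM)
  also have "\<dots> = (\<Prod>i\<in>UNIV. ennreal (\<Prod>b\<in>Basis. (u $ i - l $ i) \<bullet> b))"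
    using lu' by (intro prod.cong refl emeasure_lborel_box) auto
  also have "\<dots> = ennreal (\<Prod>i\<in>UNIV. \<Prod>b\<in>Basis. (u $ i - l $ i) \<bullet> b)"
    using lu' by (intro prod_ennreal prod_nonneg) (auto simp: inner_diff_left)
  also have "\<dots> = ennreal (\<Prod>b\<in>Basis. (u - l) \<bullet> b)"
    by (simp add: prod_Basis_vec inner_axis)
  finally show "emeasure (distr (Pi\<^sub>M UNIV (\<lambda>_::'p. lborel :: 'a measure)) borel vec_lambda) (box l u)
      = ennreal (\<Prod>b\<in>Basis. (u - l) \<bullet> b)" .
qed simp

lemma compact_cartesian_power:
  fixes K :: "'a::euclidean_space set"
  assumes "compact K" shows "compact (cartesian_power K :: ('a ^ 'p) set)"
proof -
  have "closed (cartesian_power K :: ('a ^ 'p) set)"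
  proof -
    have "(cartesian_power K :: ('a ^ 'p) set) = (\<Inter>i. (\<lambda>x. x $ i) -` K)"
      by (auto simp: cartesian_power_def)
    moreover have "closed ((\<lambda>x::'a ^ 'p. x $ i) -` K)" for i
      using compact_imp_closed[OF assms] by (intro closed_vimage) (auto intro: continuous_intros)
    ultimately show ?thesis by auto
  qed
  moreover have "bounded (cartesian_power K :: ('a ^ 'p) set)"
  proof -
    obtain B where B: "\<And>x. x \<in> K \<Longrightarrow> norm x \<le> B" using compact_imp_bounded[OF assms] by (auto simp: bounded_iff)
    have "norm x \<le> (\<Sum>i\<in>(UNIV::'p set). B)" if "x \<in> cartesian_power K" for x :: "'a ^ 'p"
    proof -
      have "norm x \<le> (\<Sum>i\<in>UNIV. norm (x $ i))" unfolding norm_vec_def by (rule L2_set_le_sum) auto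
      also have "\<dots> \<le> (\<Sum>i\<in>(UNIV::'p set). B)" using that B by (intro sum_mono) (auto simp: cartesian_power_def)
      finally show ?thesis .
    qed
    then show ?thesis unfolding bounded_iff by blast
  qed
  ultimately show ?thesis by (simp add: compact_eq_bounded_closed)
qed

lemma convex_cartesian_power:
  "convex K \<Longrightarrow> convex (cartesian_power K :: ('a::real_vector ^ 'p) set)"
  by (auto simp: convex_def cartesian_power_def)

lemma emeasure_cartesian_power:
  fixes K :: "'a::euclidean_space set"
  assumes "compact K"
  shows "emeasure lborel (cartesian_power K :: ('a ^ 'p) set) = emeasure lborel K ^ CARD('p)"
proof -
  interpret product_sigma_finite "\<lambda>_::'p. lborel :: 'a measure" ..
  let ?P = "Pi\<^sub>M UNIV (\<lambda>_::'p. lborel :: 'a measure)"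
  note [measurable] = borel_measurable_vec_lambda
  have "vec_lambda -` cartesian_power K \<inter> space ?P = (\<Pi>\<^sub>E i\<in>UNIV. K)"
    by (auto simp: cartesian_power_def space_PiM PiE_iff)
  then have "emeasure lborel (cartesian_power K :: ('a ^ 'p) set) = emeasure ?P (\<Pi>\<^sub>E i\<in>UNIV. K)"
    using borel_compact[OF compact_cartesian_power[OF assms]]
    by (subst lborel_vec_eq_distr, subst emeasure_distr) auto
  also have "\<dots> = (\<Prod>i\<in>(UNIV::'p set). emeasure lborel K)"
    using assms by (intro emeasure_PiM) (auto simp: borel_compact)
  finally show ?thesis by simp
qed

text \<open>The substitution s = \<rho> + x / a leads to the integral of x^k exp(-x), which is k!.
  The shift by \<rho> survives only as the factor exp(- a \<rho>); this is what separates the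
  variables later.\<close>

lemma nn_integral_shifted_gamma:
  fixes a \<rho> :: real
  assumes a: "a > 0"
  shows "(\<integral>\<^sup>+s. ennreal ((s - \<rho>) ^ k * exp (- a * s)) * indicator {0..} (s - \<rho>) \<partial>lborel)
    = ennreal (exp (- a * \<rho>) * fact k / a ^ Suc k)"
proof -
  have "(\<integral>\<^sup>+s. ennreal ((s - \<rho>) ^ k * exp (- a * s)) * indicator {0..} (s - \<rho>) \<partial>lborel)
      = ennreal (1 / a) * (\<integral>\<^sup>+x. ennreal ((\<rho> + (1 / a) * x - \<rho>) ^ k * exp (- a * (\<rho> + (1 / a) * x)))
          * indicator {0..} (\<rho> + (1 / a) * x - \<rho>) \<partial>lborel)"
    using a by (subst nn_integral_real_affine[where c = "1 / a" and t = \<rho>]) auto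
  also have "(\<integral>\<^sup>+x. ennreal ((\<rho> + (1 / a) * x - \<rho>) ^ k * exp (- a * (\<rho> + (1 / a) * x)))
          * indicator {0..} (\<rho> + (1 / a) * x - \<rho>) \<partial>lborel)
      = (\<integral>\<^sup>+x. ennreal (exp (- a * \<rho>) / a ^ k) * (ennreal (x ^ k * exp (- x)) * indicator {0..} x) \<partial>lborel)"
  proof (rule nn_integral_cong)
    fix x :: real
    have "(\<rho> + (1 / a) * x - \<rho>) ^ k * exp (- a * (\<rho> + (1 / a) * x)) = exp (- a * \<rho>) / a ^ k * (x ^ k * exp (- x))"
      using a by (simp add: power_divide field_simps exp_diff[symmetric] exp_add[symmetric] exp_minus)
    then show "ennreal ((\<rho> + (1 / a) * x - \<rho>) ^ k * exp (- a * (\<rho> + (1 / a) * x))) * indicator {0..} (\<rho> + (1 / a) * x - \<rho>)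
      = ennreal (exp (- a * \<rho>) / a ^ k) * (ennreal (x ^ k * exp (- x)) * indicator {0..} x)"
      using a by (auto simp: zero_le_divide_iff ennreal_mult'[symmetric] split: split_indicator)
  qed
  also have "\<dots> = ennreal (exp (- a * \<rho>) / a ^ k) * ennreal (fact k)"
    by (subst nn_integral_cmult) (auto simp: nn_intergal_power_times_exp_Ici)
  finally show ?thesis
    using a by (simp add: ennreal_mult'[symmetric] mult_ac)
qed

lemma nn_integral_power_Icc:
  fixes R :: real
  assumes "R \<ge> 0" "n > 0"
  shows "(\<integral>\<^sup>+\<rho>. ennreal (n * \<rho> ^ (n - 1)) * indicator {0..R} \<rho> \<partial>lborel) = ennreal (R ^ n)"
proof -
  have "(\<integral>\<^sup>+\<rho>. ennreal (n * \<rho> ^ (n - 1)) * indicator {0..R} \<rho> \<partial>lborel) = ennreal (R ^ n - 0 ^ n)"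
    using assms by (intro nn_integral_FTC_Icc) (auto intro!: derivative_eq_intros)
  then show ?thesis using assms by simp
qed

lemma emeasure_lborel_homothety:
  fixes S :: "'a::euclidean_space set"
  assumes "compact S" "m \<ge> 0"
  shows "emeasure lborel ((\<lambda>x. m *\<^sub>R x + d) ` S) = ennreal (m ^ DIM('a)) * emeasure lborel S"
proof -
  have "compact ((\<lambda>x. m *\<^sub>R x + d) ` S)"
    using assms by (intro compact_continuous_image continuous_intros)
  then show ?thesis
    using emeasure_lebesgue_affine[of m d S] assms by (simp add: borel_compact)
qed

text \<open>The fibre over \<open>x\<close> of \<open>{(x, w). w \<in> S K, x + \<Delta> w \<in> T K\<^sup>p}\<close>, a set of volume
  \<open>S\<^sup>n |K| T\<^sup>n\<^sup>p |K|\<^sup>p\<close>.\<close>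
definition dilated_fibre :: "'a::euclidean_space set \<Rightarrow> real \<Rightarrow> real \<Rightarrow> 'a ^ 'p \<Rightarrow> 'a set" where
  "dilated_fibre K S T x = {w \<in> (\<lambda>y. S *\<^sub>R y) ` K. x + vec w \<in> (\<lambda>y. T *\<^sub>R y) ` cartesian_power K}"

lemma vec_scaleR: "vec (c *\<^sub>R x) = c *\<^sub>R vec x"
  by (simp add: vec_eq_iff)

lemma vec_plus: "vec (x + y) = vec x + vec y"
  by (simp add: vec_eq_iff)

lemma linear_vec: "linear (vec :: 'a::real_vector \<Rightarrow> 'a ^ 'p)"
  by (intro linearI vec_scaleR vec_plus)

lemma compact_vec_image:
  fixes K :: "'a::euclidean_space set"
  shows "compact K \<Longrightarrow> compact (vec ` K :: ('a ^ 'p) set)"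
  by (rule compact_continuous_image) (auto intro: linear_continuous_on simp: linear_vec linear_conv_bounded_linear[symmetric])

text \<open>Let x = - (S - \<rho>) \<Delta> s + (T - \<rho>) m. The shift d = (S - \<rho>) s cancels
  the diagonal term: for k in K, the point w = \<rho> k + d lies in S K, and x + \<Delta> w = \<rho>
  \<Delta> k + (T - \<rho>) m lies in T K^p, both by convexity.\<close>

lemma dilated_fibre_superset:
  fixes K :: "'a::euclidean_space set"
  assumes K: "convex K" and \<rho>: "0 \<le> \<rho>" "\<rho> \<le> S" "\<rho> \<le> T"
    and x: "x \<in> minkowski_comb (S - \<rho>) (uminus ` (vec ` K)) (T - \<rho>) (cartesian_power K :: ('a ^ 'p) set)"
  obtains d where "(\<lambda>y. \<rho> *\<^sub>R y + d) ` K \<subseteq> dilated_fibre K S T x"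
proof -
  obtain s m where s: "s \<in> K" and m: "m \<in> (cartesian_power K :: ('a ^ 'p) set)"
    and xeq: "x = (S - \<rho>) *\<^sub>R (- vec s) + (T - \<rho>) *\<^sub>R m"
    using x by (auto simp: mem_minkowski_comb)
  show ?thesis
  proof (rule that[of "(S - \<rho>) *\<^sub>R s"], safe)
    fix k assume k: "k \<in> K"
    let ?w = "\<rho> *\<^sub>R k + (S - \<rho>) *\<^sub>R s"
    have "?w \<in> (\<lambda>y. S *\<^sub>R y) ` K"
      using scaled_convex_add[OF K k s, of \<rho> "S - \<rho>"] \<rho> by simp
    moreover have "x + vec ?w = \<rho> *\<^sub>R vec k + (T - \<rho>) *\<^sub>R m"
      by (simp add: xeq vec_scaleR vec_plus)
    moreover have "vec k \<in> (cartesian_power K :: ('a ^ 'p) set)" using k by (simp add: cartesian_power_def)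
    then have "\<rho> *\<^sub>R vec k + (T - \<rho>) *\<^sub>R m \<in> (\<lambda>y. T *\<^sub>R y) ` cartesian_power K"
      using scaled_convex_add[OF convex_cartesian_power[OF K] _ m, of "vec k" \<rho> "T - \<rho>"] \<rho> by simp
    ultimately show "?w \<in> dilated_fibre K S T x" by (simp add: dilated_fibre_def)
  qed
qed

lemma compact_dilated_fibre:
  fixes K :: "'a::euclidean_space set"
  assumes "compact K" shows "compact (dilated_fibre K S T (x :: 'a ^ 'p))"
proof -
  have "continuous_on UNIV (\<lambda>w. x + vec w)"
    by (intro continuous_intros linear_continuous_on) (simp add: linear_vec linear_conv_bounded_linear[symmetric])
  moreover have "closed ((\<lambda>y. T *\<^sub>R y) ` (cartesian_power K :: ('a ^ 'p) set))"
    using compact_cartesian_power[OF assms] by (intro compact_imp_closed compact_scaling)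
  ultimately have "closed ((\<lambda>w. x + vec w) -` ((\<lambda>y. T *\<^sub>R y) ` (cartesian_power K :: ('a ^ 'p) set)))"
    by (simp add: closed_vimage)
  then have "compact ((\<lambda>y. S *\<^sub>R y) ` K \<inter> (\<lambda>w. x + vec w) -` ((\<lambda>y. T *\<^sub>R y) ` (cartesian_power K :: ('a ^ 'p) set)))"
    using assms by (intro compact_Int_closed compact_scaling)
  then show ?thesis
    by (simp add: dilated_fibre_def Int_def vimage_def)
qed

text \<open>\<open>R\<close> is the factor for which R K has the volume of the fibre. Whenever x
  lies in the combination for some \<rho>, the fibre contains a translate of \<rho> K, so \<rho>
  \<le> R; and |K| n \<rho>^(n-1) integrates over 0 \<le> \<rho> \<le> R to exactly the volume of
  the fibre.\<close>

lemma layer_cake_dilated_fibre: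
  fixes K :: "'a::euclidean_space set" and x :: "'a ^ 'p"
  assumes K: "compact K" "convex K" and pos: "measure lborel K > 0"
  shows "(\<integral>\<^sup>+\<rho>. ennreal (measure lborel K) * (ennreal (DIM('a) * \<rho> ^ (DIM('a) - 1)) * indicator {0..min S T} \<rho> *
       indicator (minkowski_comb (S - \<rho>) (uminus ` (vec ` K)) (T - \<rho>) (cartesian_power K)) x) \<partial>lborel)
    \<le> emeasure lborel (dilated_fibre K S T x)"
proof -
  let ?n = "DIM('a)"
  let ?F = "dilated_fibre K S T x"
  let ?k = "measure lborel K"
  have fin: "emeasure lborel C < \<infinity>" if "compact C" for C :: "'a set"
    using emeasure_bounded_finite[OF compact_imp_bounded[OF that]] .
  have k: "emeasure lborel K = ennreal ?k"
    using fin[OF K(1)] by (intro emeasure_eq_ennreal_measure) auto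
  define R where "R = root ?n (measure lborel ?F / ?k)"
  have n: "?n > 0" by simp
  have R0: "R \<ge> 0" unfolding R_def using pos n by (intro real_root_ge_zero) auto
  have Rn: "R ^ ?n = measure lborel ?F / ?k"
    unfolding R_def using n pos by (intro real_root_pow_pos2) auto
  have le: "\<rho> \<le> R" if "0 \<le> \<rho>" "\<rho> \<le> S" "\<rho> \<le> T"
      "x \<in> minkowski_comb (S - \<rho>) (uminus ` (vec ` K)) (T - \<rho>) (cartesian_power K)" for \<rho>
  proof -
    from dilated_fibre_superset[OF K(2) that]
    obtain d where d: "(\<lambda>y. \<rho> *\<^sub>R y + d) ` K \<subseteq> ?F" .
    have "ennreal (\<rho> ^ ?n * ?k) = emeasure lborel ((\<lambda>y. \<rho> *\<^sub>R y + d) ` K)"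
      using that by (simp add: emeasure_lborel_homothety[OF K(1)] k ennreal_mult)
    also have "\<dots> \<le> emeasure lborel ?F"
      using d borel_compact[OF compact_dilated_fibre[OF K(1)]] by (intro emeasure_mono) auto
    also have "\<dots> = ennreal (measure lborel ?F)"
      using fin[OF compact_dilated_fibre[OF K(1), of S T x]] by (intro emeasure_eq_ennreal_measure) auto
    finally have "\<rho> ^ ?n * ?k \<le> measure lborel ?F" by (simp add: ennreal_le_iff)
    then have "\<rho> ^ ?n \<le> R ^ ?n" using pos by (simp add: Rn field_simps)
    then show ?thesis using power_le_imp_le_base[of \<rho> "?n - 1" R] n R0 by simp
  qed
  have "(\<integral>\<^sup>+\<rho>. ennreal ?k * (ennreal (?n * \<rho> ^ (?n - 1)) * indicator {0..min S T} \<rho> *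
       indicator (minkowski_comb (S - \<rho>) (uminus ` (vec ` K)) (T - \<rho>) (cartesian_power K)) x) \<partial>lborel)
    \<le> (\<integral>\<^sup>+\<rho>. ennreal ?k * (ennreal (?n * \<rho> ^ (?n - 1)) * indicator {0..R} \<rho>) \<partial>lborel)"
    using le by (intro nn_integral_mono) (auto split: split_indicator)
  also have "\<dots> = ennreal ?k * ennreal (R ^ ?n)"
    using nn_integral_power_Icc[OF R0 n] by (subst nn_integral_cmult) auto
  also have "\<dots> = ennreal (measure lborel ?F)"
    using pos by (simp add: Rn ennreal_mult'[symmetric])
  also have "\<dots> = emeasure lborel ?F"
    using fin[OF compact_dilated_fibre[OF K(1), of S T x]] by (intro emeasure_eq_ennreal_measure[symmetric]) auto
  finally show ?thesis .
qed

text \<open>Tonelli on the pairs (x, w): for fixed w in S K, the admissible x form a translate of T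
  K^p.\<close>

lemma nn_integral_dilated_fibre:
  fixes K :: "'a::euclidean_space set"
  assumes K: "compact K" and ST: "S \<ge> 0" "T \<ge> 0"
  shows "(\<integral>\<^sup>+x. emeasure lborel (dilated_fibre K S T (x :: 'a ^ 'p)) \<partial>lborel)
    = ennreal (S ^ DIM('a) * measure lborel K * T ^ (CARD('p) * DIM('a)) * measure lborel K ^ CARD('p))"
proof -
  let ?SK = "(\<lambda>y. S *\<^sub>R y) ` K" and ?TM = "(\<lambda>y. T *\<^sub>R y) ` (cartesian_power K :: ('a ^ 'p) set)"
  have k: "emeasure lborel K = ennreal (measure lborel K)"
    using emeasure_bounded_finite[OF compact_imp_bounded[OF K]] by (intro emeasure_eq_ennreal_measure) auto
  have [measurable]: "?SK \<in> sets borel" "?TM \<in> sets borel"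
    using K compact_cartesian_power[OF K] by (auto intro!: borel_compact compact_scaling)
  have [measurable]: "(vec :: 'a \<Rightarrow> 'a ^ 'p) \<in> borel_measurable borel"
    by (rule borel_measurable_linear[OF linear_vec])
  have "(\<integral>\<^sup>+x. emeasure lborel (dilated_fibre K S T (x :: 'a ^ 'p)) \<partial>lborel)
      = (\<integral>\<^sup>+x. (\<integral>\<^sup>+w. indicator ?SK w * indicator ?TM (x + vec w) \<partial>lborel) \<partial>lborel)"
  proof (rule nn_integral_cong)
    fix x :: "'a ^ 'p"
    have "emeasure lborel (dilated_fibre K S T x) = (\<integral>\<^sup>+w. indicator (dilated_fibre K S T x) w \<partial>lborel)"
      using borel_compact[OF compact_dilated_fibre[OF K]] by (subst nn_integral_indicator) auto
    also have "\<dots> = (\<integral>\<^sup>+w. indicator ?SK w * indicator ?TM (x + vec w) \<partial>lborel)"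
      by (intro nn_integral_cong) (auto simp: dilated_fibre_def split: split_indicator)
    finally show "emeasure lborel (dilated_fibre K S T x) = \<dots>" .
  qed
  also have "\<dots> = (\<integral>\<^sup>+w. (\<integral>\<^sup>+x. indicator ?SK w * indicator ?TM (x + vec w) \<partial>lborel) \<partial>lborel)"
    by (rule lborel_pair.Fubini'[symmetric]) measurable
  also have "\<dots> = (\<integral>\<^sup>+w. emeasure lborel ?TM * indicator ?SK w \<partial>lborel)"
  proof (rule nn_integral_cong)
    fix w :: 'a
    have "(\<integral>\<^sup>+x. indicator ?TM (x + vec w) \<partial>lborel) = (\<integral>\<^sup>+x. indicator ?TM x \<partial>distr lborel borel ((+) (vec w)))"
      by (subst nn_integral_distr) (auto simp: add.commute)
    also have "\<dots> = emeasure lborel ?TM" by (simp add: lborel_distr_plus)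
    finally show "(\<integral>\<^sup>+x. indicator ?SK w * indicator ?TM (x + vec w) \<partial>lborel) = emeasure lborel ?TM * indicator ?SK w"
      by (subst nn_integral_cmult) (auto simp: mult.commute)
  qed
  also have "\<dots> = emeasure lborel ?TM * emeasure lborel ?SK"
    by (subst nn_integral_cmult_indicator) auto
  also have "emeasure lborel ?SK = ennreal (S ^ DIM('a) * measure lborel K)"
    using emeasure_lborel_homothety[OF K ST(1), of 0] ST by (simp add: k ennreal_mult)
  also have "emeasure lborel ?TM = ennreal (T ^ (CARD('p) * DIM('a)) * measure lborel K ^ CARD('p))"
    using emeasure_lborel_homothety[of "cartesian_power K :: ('a ^ 'p) set" T 0] compact_cartesian_power[OF K] ST
    by (simp add: emeasure_cartesian_power[OF K] k ennreal_mult ennreal_power)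
  finally show ?thesis using ST by (simp add: ennreal_mult[symmetric] mult_ac)
qed

text \<open>The layer bound holds for each x. Integrating it over x and exchanging with the integral
  over \<rho> turns the indicator of the combination into its volume.\<close>

lemma fibre_inequality:
  fixes K :: "'a::euclidean_space set"
  assumes K: "compact K" "convex K" and pos: "measure lborel K > 0" and ST: "S \<ge> 0" "T \<ge> 0"
  shows "(\<integral>\<^sup>+\<rho>. ennreal (measure lborel K) * (ennreal (DIM('a) * \<rho> ^ (DIM('a) - 1)) * indicator {0..min S T} \<rho> *
       emeasure lborel (minkowski_comb (S - \<rho>) (uminus ` (vec ` K)) (T - \<rho>) (cartesian_power K :: ('a ^ 'p) set))) \<partial>lborel)
    \<le> ennreal (S ^ DIM('a) * measure lborel K * T ^ (CARD('p) * DIM('a)) * measure lborel K ^ CARD('p))"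
proof -
  let ?k = "measure lborel K" and ?n = "DIM('a)"
  let ?M = "\<lambda>\<rho>. minkowski_comb (S - \<rho>) (uminus ` (vec ` K)) (T - \<rho>) (cartesian_power K :: ('a ^ 'p) set)"
  have cL: "compact (uminus ` (vec ` K) :: ('a ^ 'p) set)"
    using compact_negations[OF compact_vec_image[OF K(1)]] .
  have cM: "compact (?M \<rho>)" for \<rho>
    by (intro compact_minkowski_comb cL compact_cartesian_power K)
  \<comment> \<open>For joint measurability in (x, \<rho>), all combinations with \<rho> in the
    interval are gathered in one set, which is compact as a continuous image.\<close>
  define Z where "Z = (\<lambda>(l, m, \<rho>). ((S - \<rho>) *\<^sub>R l + (T - \<rho>) *\<^sub>R m, \<rho>)) `
     (uminus ` (vec ` K) \<times> (cartesian_power K :: ('a ^ 'p) set) \<times> {0..min S T})"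
  have "compact Z"
    unfolding Z_def case_prod_beta
    by (intro compact_continuous_image compact_Times cL compact_cartesian_power K compact_Icc continuous_intros)
  then have [measurable]: "Z \<in> sets (borel \<Otimes>\<^sub>M borel)"
    unfolding borel_prod by (rule borel_compact)
  have Z: "indicator Z (x, \<rho>) = (indicator {0..min S T} \<rho> * indicator (?M \<rho>) x :: ennreal)" for x \<rho>
    by (force simp: Z_def mem_minkowski_comb image_iff split: split_indicator)
  let ?f = "\<lambda>x (\<rho> :: real). ennreal ?k * (ennreal (?n * \<rho> ^ (?n - 1)) * indicator Z (x, \<rho>))"
  have "(\<integral>\<^sup>+\<rho>. ennreal ?k * (ennreal (?n * \<rho> ^ (?n - 1)) * indicator {0..min S T} \<rho> * emeasure lborel (?M \<rho>)) \<partial>lborel)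
      = (\<integral>\<^sup>+\<rho>. (\<integral>\<^sup>+x. ?f x \<rho> \<partial>lborel) \<partial>lborel)"
  proof (rule nn_integral_cong)
    fix \<rho> :: real
    have [measurable]: "?M \<rho> \<in> sets borel" by (rule borel_compact[OF cM])
    have "(\<integral>\<^sup>+x. ?f x \<rho> \<partial>lborel) = (\<integral>\<^sup>+x. ennreal ?k * (ennreal (?n * \<rho> ^ (?n - 1)) * indicator {0..min S T} \<rho>) * indicator (?M \<rho>) x \<partial>lborel)"
      by (simp add: Z mult_ac)
    also have "\<dots> = ennreal ?k * (ennreal (?n * \<rho> ^ (?n - 1)) * indicator {0..min S T} \<rho>) * emeasure lborel (?M \<rho>)"
      by (rule nn_integral_cmult_indicator) simp
    finally show "ennreal ?k * (ennreal (?n * \<rho> ^ (?n - 1)) * indicator {0..min S T} \<rho> * emeasure lborel (?M \<rho>))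
      = (\<integral>\<^sup>+x. ?f x \<rho> \<partial>lborel)" by (simp add: mult_ac)
  qed
  also have "\<dots> = (\<integral>\<^sup>+x. (\<integral>\<^sup>+\<rho>. ?f x \<rho> \<partial>lborel) \<partial>lborel)"
    by (rule lborel_pair.Fubini') measurable
  also have "\<dots> \<le> (\<integral>\<^sup>+x. emeasure lborel (dilated_fibre K S T (x :: 'a ^ 'p)) \<partial>lborel)"
    using layer_cake_dilated_fibre[OF K pos, of S T] by (intro nn_integral_mono) (simp add: Z mult_ac)
  also have "\<dots> = ennreal (S ^ ?n * ?k * T ^ (CARD('p) * ?n) * ?k ^ CARD('p))"
    by (rule nn_integral_dilated_fibre[OF K(1) ST])
  finally show ?thesis .
qed

text \<open>A compact convex set of volume zero lies in a hyperplane with normal a. In any one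
  coordinate i, a point of the combination is a difference of two points of K, hence orthogonal to
  a; so the whole combination lies in the hyperplane with normal \<open>axis i a\<close>.\<close>

lemma measure_minkowski_comb_eq_0:
  fixes K :: "'a::euclidean_space set"
  assumes K: "compact K" "convex K" and "measure lebesgue K = 0"
  shows "measure lebesgue (minkowski_comb 1 (uminus ` (vec ` K)) 1 (cartesian_power K :: ('a ^ 'p) set)) = 0"
proof -
  have "negligible K"
    using assms lmeasurable_compact[OF K(1)] by (simp add: negligible_iff_measure)
  then obtain a b where ab: "a \<noteq> 0" "K \<subseteq> {x. a \<bullet> x = b}"
    using negligible_convex_interior[OF K(2)] empty_interior_subset_hyperplane[OF K(2)] by metis
  obtain i :: 'p where True by blast
  have "minkowski_comb 1 (uminus ` (vec ` K)) 1 (cartesian_power K :: ('a ^ 'p) set) \<subseteq> {y. axis i a \<bullet> y = 0}"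
  proof
    fix y assume "y \<in> minkowski_comb 1 (uminus ` (vec ` K)) 1 (cartesian_power K :: ('a ^ 'p) set)"
    then obtain s m where "s \<in> K" "m $ i \<in> K" "y = m - vec s"
      by (auto simp: mem_minkowski_comb cartesian_power_def)
    then show "y \<in> {y. axis i a \<bullet> y = 0}"
      using ab(2) by (auto simp: inner_axis' inner_diff_right)
  qed
  moreover have "axis i a \<noteq> 0" using ab(1) by (simp add: axis_eq_0_iff)
  then have "negligible {y. axis i a \<bullet> y = 0}" by (intro negligible_hyperplane) auto
  ultimately show ?thesis using negligible_subset negligible_imp_measure0 by blast
qed

text \<open>Integrating the fibre inequality against the weight \<open>exp (- \<alpha> S - \<beta> T)\<close> turns both sides into
  products of Gamma integrals.\<close>
lemma minkowski_coefficient_bound: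
  fixes \<alpha> \<beta> :: real and n :: nat
  assumes fibre: "\<And>S T. S \<ge> 0 \<Longrightarrow> T \<ge> 0 \<Longrightarrow>
      (\<integral>\<^sup>+\<rho>. ennreal k * (ennreal (n * \<rho> ^ (n - 1)) * indicator {0..min S T} \<rho> * ennreal (c * (S - \<rho>) ^ j * (T - \<rho>) ^ (N - j))) \<partial>lborel)
      \<le> ennreal (S ^ n * k * T ^ N * k ^ p)"
    and k: "k > 0" and c: "c \<ge> 0" and j: "0 < n" "j \<le> n" "j \<le> N"
    and \<alpha>\<beta>: "\<alpha> > 0" "\<beta> > 0" "\<alpha> + \<beta> = 1"
  shows "c * fact j * fact (N - j) / fact N \<le> k ^ p / (\<alpha> ^ (n - j) * \<beta> ^ j)"
proof -
  note n = \<open>0 < n\<close>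
  \<comment> \<open>The range 0 \<le> \<rho> \<le> min S T is split into three indicators, one each
    in \<open>h\<close>, \<open>u\<close> and \<open>v\<close>, so that for fixed \<rho> the
    integrand is a product in which S and T are separated.\<close>
  define h :: "real \<Rightarrow> ennreal" where "h \<rho> = ennreal (c * k * n * \<rho> ^ (n - 1)) * indicator {0..} \<rho>" for \<rho>
  define u :: "real \<Rightarrow> real \<Rightarrow> ennreal" where "u S \<rho> = ennreal ((S - \<rho>) ^ j * exp (- \<alpha> * S)) * indicator {0..} (S - \<rho>)" for S \<rho>
  define v :: "real \<Rightarrow> real \<Rightarrow> ennreal" where "v T \<rho> = ennreal ((T - \<rho>) ^ (N - j) * exp (- \<beta> * T)) * indicator {0..} (T - \<rho>)" for T \<rho>
  define A :: "real \<Rightarrow> ennreal" where "A S = ennreal (S ^ n * exp (- \<alpha> * S)) * indicator {0..} S" for S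
  define B :: "real \<Rightarrow> ennreal" where "B T = ennreal (T ^ N * exp (- \<beta> * T)) * indicator {0..} T" for T
  have [measurable]: "h \<in> borel_measurable borel" "A \<in> borel_measurable borel" "B \<in> borel_measurable borel"
    unfolding h_def A_def B_def by measurable
  have [measurable]: "case_prod u \<in> borel_measurable (borel \<Otimes>\<^sub>M borel)" "case_prod v \<in> borel_measurable (borel \<Otimes>\<^sub>M borel)"
    unfolding u_def v_def case_prod_beta by measurable
  have pointwise: "(\<integral>\<^sup>+\<rho>. h \<rho> * (u S \<rho> * v T \<rho>) \<partial>lborel) \<le> ennreal (k * k ^ p) * (A S * B T)" for S T
  proof (cases "S \<ge> 0 \<and> T \<ge> 0")
    case True
    let ?e = "exp (- \<alpha> * S) * exp (- \<beta> * T)"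
    let ?g = "\<lambda>\<rho>::real. ennreal k * (ennreal (n * \<rho> ^ (n - 1)) * indicator {0..min S T} \<rho> * ennreal (c * (S - \<rho>) ^ j * (T - \<rho>) ^ (N - j)))"
    have "(\<integral>\<^sup>+\<rho>. h \<rho> * (u S \<rho> * v T \<rho>) \<partial>lborel) = (\<integral>\<^sup>+\<rho>. ennreal ?e * ?g \<rho> \<partial>lborel)"
    proof (rule nn_integral_cong)
      fix \<rho> :: real
      show "h \<rho> * (u S \<rho> * v T \<rho>) = ennreal ?e * ?g \<rho>"
      proof (cases "0 \<le> \<rho> \<and> \<rho> \<le> S \<and> \<rho> \<le> T")
        case True
        then have "h \<rho> * (u S \<rho> * v T \<rho>)
          = ennreal ((c * k * n * \<rho> ^ (n - 1)) * (((S - \<rho>) ^ j * exp (- \<alpha> * S)) * ((T - \<rho>) ^ (N - j) * exp (- \<beta> * T))))"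
          using c k by (simp add: h_def u_def v_def ennreal_mult[symmetric])
        also have "\<dots> = ennreal (?e * (k * ((n * \<rho> ^ (n - 1)) * (c * (S - \<rho>) ^ j * (T - \<rho>) ^ (N - j)))))"
          by (simp add: mult_ac)
        also have "\<dots> = ennreal ?e * ?g \<rho>"
          using True c k by (simp add: ennreal_mult)
        finally show ?thesis .
      qed (auto simp: h_def u_def v_def split: split_indicator)
    qed
    also have "\<dots> = ennreal ?e * (\<integral>\<^sup>+\<rho>. ?g \<rho> \<partial>lborel)"
      by (rule nn_integral_cmult) measurable
    also have "\<dots> \<le> ennreal ?e * ennreal (S ^ n * k * T ^ N * k ^ p)"
      using fibre[of S T] True by (intro mult_left_mono) auto
    also have "\<dots> = ennreal (k * k ^ p) * (A S * B T)"
      using True k by (simp add: A_def B_def ennreal_mult[symmetric] mult_ac)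
    finally show ?thesis .
  next
    case False
    then have "(\<integral>\<^sup>+\<rho>. h \<rho> * (u S \<rho> * v T \<rho>) \<partial>lborel) = (\<integral>\<^sup>+(\<rho> :: real). 0 \<partial>lborel)"
      by (intro nn_integral_cong) (auto simp: h_def u_def v_def split: split_indicator)
    then show ?thesis by simp
  qed
  \<comment> \<open>The integrals of \<open>u\<close> over S and of \<open>v\<close> over T at
    \<rho> = 0; for other \<rho> they acquire an exponential factor.\<close>
  define a where "a = fact j / \<alpha> ^ Suc j"
  define b where "b = fact (N - j) / \<beta> ^ Suc (N - j)"
  have ab: "a > 0" "b > 0" using \<alpha>\<beta> by (auto simp: a_def b_def)
  have U: "(\<integral>\<^sup>+S. u S \<rho> \<partial>lborel) = ennreal (exp (- \<alpha> * \<rho>) * a)" for \<rho>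
    unfolding u_def nn_integral_shifted_gamma[OF \<alpha>\<beta>(1)] by (simp add: a_def)
  have V: "(\<integral>\<^sup>+T. v T \<rho> \<partial>lborel) = ennreal (exp (- \<beta> * \<rho>) * b)" for \<rho>
    unfolding v_def nn_integral_shifted_gamma[OF \<alpha>\<beta>(2)] by (simp add: b_def)
  have IA: "(\<integral>\<^sup>+S. A S \<partial>lborel) = ennreal (fact n / \<alpha> ^ Suc n)"
    using nn_integral_shifted_gamma[OF \<alpha>\<beta>(1), of 0 n] by (simp add: A_def)
  have IB: "(\<integral>\<^sup>+T. B T \<partial>lborel) = ennreal (fact N / \<beta> ^ Suc N)"
    using nn_integral_shifted_gamma[OF \<alpha>\<beta>(2), of 0 N] by (simp add: B_def)
  have "(\<integral>\<^sup>+S. (\<integral>\<^sup>+T. (\<integral>\<^sup>+\<rho>. h \<rho> * (u S \<rho> * v T \<rho>) \<partial>lborel) \<partial>lborel) \<partial>lborel)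
      = (\<integral>\<^sup>+S. (\<integral>\<^sup>+\<rho>. h \<rho> * (u S \<rho> * ennreal (exp (- \<beta> * \<rho>) * b)) \<partial>lborel) \<partial>lborel)"
  proof (rule nn_integral_cong)
    fix S :: real
    have "(\<integral>\<^sup>+T. (\<integral>\<^sup>+\<rho>. h \<rho> * (u S \<rho> * v T \<rho>) \<partial>lborel) \<partial>lborel)
        = (\<integral>\<^sup>+\<rho>. (\<integral>\<^sup>+T. h \<rho> * (u S \<rho> * v T \<rho>) \<partial>lborel) \<partial>lborel)"
      by (rule lborel_pair.Fubini') measurable
    also have "\<dots> = (\<integral>\<^sup>+\<rho>. h \<rho> * (u S \<rho> * ennreal (exp (- \<beta> * \<rho>) * b)) \<partial>lborel)"
      by (simp add: nn_integral_cmult V)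
    finally show "(\<integral>\<^sup>+T. (\<integral>\<^sup>+\<rho>. h \<rho> * (u S \<rho> * v T \<rho>) \<partial>lborel) \<partial>lborel) = \<dots>" .
  qed
  also have "\<dots> = (\<integral>\<^sup>+\<rho>. (\<integral>\<^sup>+S. h \<rho> * (u S \<rho> * ennreal (exp (- \<beta> * \<rho>) * b)) \<partial>lborel) \<partial>lborel)"
    by (rule lborel_pair.Fubini') measurable
  also have "\<dots> = (\<integral>\<^sup>+\<rho>. h \<rho> * (ennreal (exp (- \<alpha> * \<rho>) * a) * ennreal (exp (- \<beta> * \<rho>) * b)) \<partial>lborel)"
    by (simp add: nn_integral_cmult nn_integral_multc U)
  \<comment> \<open>Since \<alpha> + \<beta> = 1, the two exponentials combine to exp(- \<rho>), and
    the remaining Gamma integral is (n - 1)!.\<close>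
  also have "\<dots> = (\<integral>\<^sup>+\<rho>. ennreal (c * k * n * a * b) * (ennreal ((\<rho> - 0) ^ (n - 1) * exp (- 1 * \<rho>)) * indicator {0..} (\<rho> - 0)) \<partial>lborel)"
  proof (rule nn_integral_cong)
    fix \<rho> :: real
    show "h \<rho> * (ennreal (exp (- \<alpha> * \<rho>) * a) * ennreal (exp (- \<beta> * \<rho>) * b))
      = ennreal (c * k * n * a * b) * (ennreal ((\<rho> - 0) ^ (n - 1) * exp (- 1 * \<rho>)) * indicator {0..} (\<rho> - 0))"
    proof (cases "\<rho> \<ge> 0")
      case True
      have "exp (- \<alpha> * \<rho>) * exp (- \<beta> * \<rho>) = exp (- (\<alpha> + \<beta>) * \<rho>)"
        by (simp add: exp_add[symmetric] algebra_simps)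
      then have e: "exp (- \<alpha> * \<rho>) * exp (- \<beta> * \<rho>) = exp (- 1 * \<rho>)" using \<alpha>\<beta>(3) by simp
      have "h \<rho> * (ennreal (exp (- \<alpha> * \<rho>) * a) * ennreal (exp (- \<beta> * \<rho>) * b))
        = ennreal ((c * k * n * \<rho> ^ (n - 1)) * ((exp (- \<alpha> * \<rho>) * a) * (exp (- \<beta> * \<rho>) * b)))"
        using True c k ab by (simp add: h_def ennreal_mult[symmetric])
      also have "(c * k * n * \<rho> ^ (n - 1)) * ((exp (- \<alpha> * \<rho>) * a) * (exp (- \<beta> * \<rho>) * b))
        = (c * k * n * a * b) * (\<rho> ^ (n - 1) * (exp (- \<alpha> * \<rho>) * exp (- \<beta> * \<rho>)))" by (simp add: mult_ac)
      finally show ?thesis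
        unfolding e using True c k ab by (simp add: ennreal_mult)
    qed (simp add: h_def)
  qed
  also have "\<dots> = ennreal (c * k * n * a * b) * ennreal (fact (n - 1))"
    using nn_integral_shifted_gamma[of 1 0 "n - 1"] by (subst nn_integral_cmult) auto
  also have "\<dots> = ennreal (c * k * a * b * fact n)"
    using c k ab n by (simp add: ennreal_mult[symmetric] fact_reduce mult_ac)
  finally have lhs: "(\<integral>\<^sup>+S. (\<integral>\<^sup>+T. (\<integral>\<^sup>+\<rho>. h \<rho> * (u S \<rho> * v T \<rho>) \<partial>lborel) \<partial>lborel) \<partial>lborel)
    = ennreal (c * k * a * b * fact n)" .
  have "ennreal (c * k * a * b * fact n)
    \<le> (\<integral>\<^sup>+S. (\<integral>\<^sup>+T. ennreal (k * k ^ p) * (A S * B T) \<partial>lborel) \<partial>lborel)"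
    unfolding lhs[symmetric] by (intro nn_integral_mono pointwise)
  also have "\<dots> = ennreal (k * k ^ p) * (ennreal (fact n / \<alpha> ^ Suc n) * ennreal (fact N / \<beta> ^ Suc N))"
    by (simp add: nn_integral_cmult nn_integral_multc IA IB)
  also have "\<dots> = ennreal (k * k ^ p * (fact n / \<alpha> ^ Suc n * (fact N / \<beta> ^ Suc N)))"
    using k \<alpha>\<beta> by (simp add: ennreal_mult[symmetric])
  finally have le: "c * k * a * b * fact n \<le> k * k ^ p * (fact n / \<alpha> ^ Suc n * (fact N / \<beta> ^ Suc N))"
    using k \<alpha>\<beta> by (subst (asm) ennreal_le_iff) auto
  \<comment> \<open>The denominators on the right exceed those on the left by n - j factors \<alpha>
    and j factors \<beta>; \<open>?D\<close> collects what the two sides share.\<close>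
  have pow: "\<alpha> ^ Suc n = \<alpha> ^ Suc j * \<alpha> ^ (n - j)" "\<beta> ^ Suc N = \<beta> ^ Suc (N - j) * \<beta> ^ j"
    using j by (simp_all flip: power_add)
  let ?D = "k * fact n * fact N / (\<alpha> ^ Suc j * \<beta> ^ Suc (N - j))"
  have "?D > 0" using k \<alpha>\<beta> by simp
  have "c * k * a * b * fact n = ?D * (c * fact j * fact (N - j) / fact N)"
    by (simp add: a_def b_def mult_ac)
  moreover have "k * k ^ p * (fact n / \<alpha> ^ Suc n * (fact N / \<beta> ^ Suc N)) = ?D * (k ^ p / (\<alpha> ^ (n - j) * \<beta> ^ j))"
    unfolding pow by (simp add: mult_ac)
  ultimately have "?D * (c * fact j * fact (N - j) / fact N) \<le> ?D * (k ^ p / (\<alpha> ^ (n - j) * \<beta> ^ j))"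
    using le by simp
  then show ?thesis using \<open>?D > 0\<close> by (simp only: mult_le_cancel_left_pos)
qed

theorem corollary1p10:
  fixes K :: "(real ^ 'n) set" and j :: nat
  assumes "CARD('n) \<ge> 2" and "0 < j" and "j < CARD('n)"
    and "convex_body K"
  shows "mixed_volume
           (replicate j (uminus ` (vec ` K :: (real ^ 'n ^ 'p) set)) @
            replicate (CARD('n) * CARD('p) - j) (cartesian_power K))
         \<le> real CARD('n) ^ CARD('n) / (real (CARD('n) - j) ^ (CARD('n) - j) * real j ^ j)
             * measure lebesgue K ^ CARD('p)"
proof -
  let ?n = "CARD('n)" and ?p = "CARD('p)" and ?k = "measure lborel K"
  let ?N = "?n * ?p"
  let ?L = "uminus ` (vec ` K :: (real ^ 'n ^ 'p) set)" and ?M = "cartesian_power K :: (real ^ 'n ^ 'p) set"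
  have K: "compact K" "convex K" "K \<noteq> {}" using assms(4) by (auto simp: convex_body_def)
  obtain x0 where "x0 \<in> K" using K by blast
  then have "vec x0 \<in> ?M" by (simp add: cartesian_power_def)
  then have M: "compact ?M" "convex ?M" "?M \<noteq> {}"
    using compact_cartesian_power[OF K(1)] convex_cartesian_power[OF K(2)] by auto
  have L: "compact ?L" "convex ?L" "?L \<noteq> {}"
    using K by (auto intro!: compact_negations compact_vec_image convex_negations convex_linear_image linear_vec)
  have dims: "DIM(real ^ 'n) = ?n" "DIM(real ^ 'n ^ 'p) = ?N" by (simp_all add: mult.commute)
  have "?p \<ge> 1" by (simp add: Suc_leI)
  then have "?n \<le> ?N" by simp
  then have jN: "j \<le> ?N" using assms(3) by linarith
  have "\<exists>C. (\<forall>k. C k \<ge> (0::real)) \<and> (\<forall>a b. a \<ge> 0 \<longrightarrow> b \<ge> 0 \<longrightarrow>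
       measure lebesgue (minkowski_comb a ?L b ?M) = (\<Sum>k\<le>?N. C k * a ^ k * b ^ (?N - k)))"
    by (rule minkowski_polynomial[OF L M], unfold dims) blast
  then obtain C where C0: "\<And>k. C k \<ge> (0::real)"
    and C: "\<And>a b. a \<ge> 0 \<Longrightarrow> b \<ge> 0 \<Longrightarrow>
       measure lebesgue (minkowski_comb a ?L b ?M) = (\<Sum>k\<le>?N. C k * a ^ k * b ^ (?N - k))"
    by blast
  have V: "mixed_volume (replicate j ?L @ replicate (?N - j) ?M) = C j * fact j * fact (?N - j) / fact ?N"
    by (rule mixed_volume_two_bodies[OF L(2,3) M(2,3) jN C])
  have kk: "measure lebesgue K = ?k" by (rule measure_lebesgue_compact[OF K(1)])
  show ?thesis
  proof (cases "?k = 0")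
    \<comment> \<open>For |K| = 0 the volume at (1, 1), which is the sum of all coefficients,
      vanishes; being nonnegative, the coefficients then vanish one by one.\<close>
    case True
    then have "(\<Sum>k\<le>?N. C k) = 0"
      using measure_minkowski_comb_eq_0[OF K(1,2), where 'p = 'p] C[of 1 1] kk by simp
    then have "C j = 0" using C0 jN by (subst (asm) sum_nonneg_eq_0_iff) auto
    then show ?thesis unfolding V using True kk by simp
  next
    case False
    then have pos: "?k > 0" by (simp add: less_le)
    \<comment> \<open>These weights maximise \<alpha>^(n-j) \<beta>^j subject to \<alpha> + \<beta>
      = 1, and so give the smallest bound.\<close>
    define \<alpha> where "\<alpha> = real (?n - j) / ?n"
    define \<beta> where "\<beta> = real j / ?n"
    have \<alpha>\<beta>: "\<alpha> > 0" "\<beta> > 0" "\<alpha> + \<beta> = 1"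
      using assms(2,3) by (auto simp: \<alpha>_def \<beta>_def add_divide_distrib[symmetric] of_nat_diff)
    have fibre: "(\<integral>\<^sup>+\<rho>. ennreal ?k * (ennreal (?n * \<rho> ^ (?n - 1)) * indicator {0..min S T} \<rho> *
          ennreal (C j * (S - \<rho>) ^ j * (T - \<rho>) ^ (?N - j))) \<partial>lborel)
        \<le> ennreal (S ^ ?n * ?k * T ^ ?N * ?k ^ ?p)" if ST: "S \<ge> 0" "T \<ge> 0" for S T
    proof -
      have "(\<integral>\<^sup>+\<rho>. ennreal ?k * (ennreal (?n * \<rho> ^ (?n - 1)) * indicator {0..min S T} \<rho> *
          ennreal (C j * (S - \<rho>) ^ j * (T - \<rho>) ^ (?N - j))) \<partial>lborel)
        \<le> (\<integral>\<^sup>+\<rho>. ennreal ?k * (ennreal (?n * \<rho> ^ (?n - 1)) * indicator {0..min S T} \<rho> *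
          emeasure lborel (minkowski_comb (S - \<rho>) ?L (T - \<rho>) ?M)) \<partial>lborel)"
      proof (rule nn_integral_mono)
        fix \<rho> :: real
        have "ennreal (C j * (S - \<rho>) ^ j * (T - \<rho>) ^ (?N - j)) \<le> emeasure lborel (minkowski_comb (S - \<rho>) ?L (T - \<rho>) ?M)"
          if \<rho>: "\<rho> \<in> {0..min S T}"
        proof -
          have cM: "compact (minkowski_comb (S - \<rho>) ?L (T - \<rho>) ?M)" by (intro compact_minkowski_comb L M)
          \<comment> \<open>S - \<rho> and T - \<rho> are nonnegative here, so every term of the
            polynomial is nonnegative and all but the one with index j may be dropped.\<close>
          have "C j * (S - \<rho>) ^ j * (T - \<rho>) ^ (?N - j) \<le> (\<Sum>k\<le>?N. C k * (S - \<rho>) ^ k * (T - \<rho>) ^ (?N - k))"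
            using jN C0 \<rho> by (intro member_le_sum) auto
          also have "\<dots> = measure lborel (minkowski_comb (S - \<rho>) ?L (T - \<rho>) ?M)"
            using C[of "S - \<rho>" "T - \<rho>"] \<rho> measure_lebesgue_compact[OF cM] by simp
          finally show ?thesis
            using emeasure_bounded_finite[OF compact_imp_bounded[OF cM]]
            by (subst emeasure_eq_ennreal_measure) (auto intro: ennreal_leI)
        qed
        then show "ennreal ?k * (ennreal (?n * \<rho> ^ (?n - 1)) * indicator {0..min S T} \<rho> *
            ennreal (C j * (S - \<rho>) ^ j * (T - \<rho>) ^ (?N - j)))
          \<le> ennreal ?k * (ennreal (?n * \<rho> ^ (?n - 1)) * indicator {0..min S T} \<rho> *
            emeasure lborel (minkowski_comb (S - \<rho>) ?L (T - \<rho>) ?M))"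
          by (cases "\<rho> \<in> {0..min S T}") (auto intro!: mult_left_mono)
      qed
      also have "\<dots> \<le> ennreal (S ^ ?n * ?k * T ^ ?N * ?k ^ ?p)"
        using fibre_inequality[OF K(1,2) pos ST, where 'p = 'p] by (simp add: mult.commute)
      finally show ?thesis .
    qed
    have "C j * fact j * fact (?N - j) / fact ?N \<le> ?k ^ ?p / (\<alpha> ^ (?n - j) * \<beta> ^ j)"
      by (rule minkowski_coefficient_bound[OF fibre pos C0 _ _ jN \<alpha>\<beta>]) (use assms(3) in auto)
    also have "\<alpha> ^ (?n - j) * \<beta> ^ j = real (?n - j) ^ (?n - j) * real j ^ j / real ?n ^ ?n"
    proof -
      have "real ?n ^ ?n = real ?n ^ (?n - j) * real ?n ^ j" using assms(3) by (simp flip: power_add)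
      then show ?thesis by (simp add: \<alpha>_def \<beta>_def power_divide)
    qed
    finally show ?thesis unfolding V kk by (simp add: mult_ac)
  qed
qed

end
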